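(* Let $G=A*_C B$ be an amalgamated free product, where $A$ has the f.c.i.p. relative to $C$, $(A,C)$ has the $C$-f.g.i.p., and $B$ has the f.g.i.p. Then $G$ has the f.g.i.p. if and only if $G$ has the f.g.i.p. relative to $C$.
   Context: Conventions: $H^g=g^{-1}Hg$; $B\backslash G/C$ is the set of double cosets $BhC$. A group $G$ has the f.g.i.p. if the intersection of any two finitely generated subgroups is finitely generated; $G$ has the f.g.i.p. relative to a subgroup $H$ if $K\cap H$ is finitely generated for every finitely generated $K\le G$. For a subgroup $A\le G$, the pair $(G,A)$ has the $A$-f.g.i.p. if $G$ has the f.g.i.p. and for all finitely generated $H,K\le G$ there are only finitely many double cosets $HgK$ with $g\in A$ and $H^g\cap K\not\le A$. f.c.i.p.: for finitely generated subgroups $A,B,C\le G$ and $f,g\in G$, let $q^A_{f,g}\colon (A\cap B^f)\backslash A/(A\cap C^g)\to B\backslash G/C$ be the (well-defined) map $(A\cap B^f)a(A\cap C^g)\mapsto B\,fag^{-1}\,C$. $G$ has the f.c.i.p. relative to a finitely generated subgroup $A$ if for every pair $B,C$ of finitely generated subgroups of $G$ and all finite sets $\mathcal F,\mathcal G\subset G$ whose elements lie in pairwise distinct $(B,A)$-double cosets, respectively $(C,A)$-double cosets, $$\sum_{BhC\in B\backslash G/C}\max\Big\{0,\Big(\sum_{f\in\mathcal F,\,g\in\mathcal G}\big|(q^A_{f,g})^{-1}(BhC)\big|\Big)-1\Big\}<\infty .$$ (The f.c.i.p. relative to a subgroup is only defined for finitely generated subgroups. The letters in these general definitions are unrelated to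 the groups $A,B,C$ of the claim.) *)

theory Defs
  imports "HOL-Algebra.Algebra" "HOL-Analysis.Infinite_Sum"
begin

section \<open>Finitely generated subgroups and the f.g.i.p.\<close>

definition fg_subgroup :: "'a set \<Rightarrow> ('a, 'm) monoid_scheme \<Rightarrow> bool" where
  "fg_subgroup H G \<longleftrightarrow> (\<exists>S. finite S \<and> S \<subseteq> carrier G \<and> H = generate G S)"

definition fgip :: "('a, 'm) monoid_scheme \<Rightarrow> bool" where
  "fgip G \<longleftrightarrow> (\<forall>H K. fg_subgroup H G \<longrightarrow> fg_subgroup K G \<longrightarrow> fg_subgroup (H \<inter> K) G)"

definition fgip_rel :: "('a, 'm) monoid_scheme \<Rightarrow> 'a set \<Rightarrow> bool" where
  "fgip_rel G H \<longleftrightarrow> subgroup H G \<and> (\<forall>K. fg_subgroup K G \<longrightarrow> fg_subgroup (K \<inter> H) G)"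


section \<open>Double cosets\<close>

definition double_coset :: "('a, 'm) monoid_scheme \<Rightarrow> 'a set \<Rightarrow> 'a \<Rightarrow> 'a set \<Rightarrow> 'a set" where
  "double_coset G H g K = H <#>\<^bsub>G\<^esub> (g <#\<^bsub>G\<^esub> K)"

definition double_cosets :: "('a, 'm) monoid_scheme \<Rightarrow> 'a set \<Rightarrow> 'a set \<Rightarrow> 'a set set" where
  "double_cosets G H K = (\<lambda>g. double_coset G H g K) ` carrier G"

definition conj_subgroup :: "('a, 'm) monoid_scheme \<Rightarrow> 'a set \<Rightarrow> 'a \<Rightarrow> 'a set" where
  "conj_subgroup G H g = (inv\<^bsub>G\<^esub> g <#\<^bsub>G\<^esub> H) #>\<^bsub>G\<^esub> g"

definition pair_fgip :: "('a, 'm) monoid_scheme \<Rightarrow> 'a set \<Rightarrow> bool" where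
  "pair_fgip G A \<longleftrightarrow> subgroup A G \<and> fgip G \<and>
     (\<forall>H K. fg_subgroup H G \<longrightarrow> fg_subgroup K G \<longrightarrow>
        finite {double_coset G H g K | g. g \<in> A \<and> \<not> conj_subgroup G H g \<inter> K \<subseteq> A})"


section \<open>The f.c.i.p.\<close>

definition ecard :: "'a set \<Rightarrow> enat" where
  "ecard U = (if finite U then enat (card U) else \<infinity>)"

text \<open>The map \<open>q\<^sup>A\<close> for \<open>f, g\<close>, from \<open>(A \<inter> B\<^sup>f)\A/(A \<inter> C\<^sup>g)\<close> to \<open>B\G/C\<close>, is given without a choice of
  representatives: \<open>D\<close> is sent to the product set \<open>B f D g\<^sup>-\<^sup>1 C\<close>. Lemma \<open>dc_map_double_coset\<close> below shows
  that the double coset of \<open>a\<close> is sent to that of \<open>f a g\<^sup>-\<^sup>1\<close>.\<close>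

definition dc_map :: "('a, 'm) monoid_scheme \<Rightarrow> 'a set \<Rightarrow> 'a set \<Rightarrow> 'a \<Rightarrow> 'a \<Rightarrow> 'a set \<Rightarrow> 'a set" where
  "dc_map G B C f g D = B <#>\<^bsub>G\<^esub> ((f <#\<^bsub>G\<^esub> D) #>\<^bsub>G\<^esub> inv\<^bsub>G\<^esub> g) <#>\<^bsub>G\<^esub> C"

definition dc_fibre ::
  "('a, 'm) monoid_scheme \<Rightarrow> 'a set \<Rightarrow> 'a set \<Rightarrow> 'a set \<Rightarrow> 'a \<Rightarrow> 'a \<Rightarrow> 'a set \<Rightarrow> 'a set set" where
  "dc_fibre G A B C f g U =
     {D \<in> double_cosets (G\<lparr>carrier := A\<rparr>) (A \<inter> conj_subgroup G B f) (A \<inter> conj_subgroup G C g).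
        dc_map G B C f g D = U}"

text \<open>Fibres may be infinite, so the sum is taken in the extended naturals, where every family is
  summable. Subtraction there is truncated, with \<open>\<infinity> - 1 = \<infinity>\<close>, so \<open>x - 1\<close> is \<open>max {0, x - 1}\<close>.\<close>

definition fcip_rel :: "('a, 'm) monoid_scheme \<Rightarrow> 'a set \<Rightarrow> bool" where
  "fcip_rel G A \<longleftrightarrow> fg_subgroup A G \<and>
     (\<forall>B C \<F> \<G>. fg_subgroup B G \<longrightarrow> fg_subgroup C G \<longrightarrow>
        finite \<F> \<longrightarrow> \<F> \<subseteq> carrier G \<longrightarrow> finite \<G> \<longrightarrow> \<G> \<subseteq> carrier G \<longrightarrow>
        inj_on (\<lambda>f. double_coset G B f A) \<F> \<longrightarrow> inj_on (\<lambda>g. double_coset G C g A) \<G> \<longrightarrow>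
        (\<Sum>\<^sub>\<infinity>U\<in>double_cosets G B C.
           (\<Sum>f\<in>\<F>. \<Sum>g\<in>\<G>. ecard (dc_fibre G A B C f g U)) - 1) < \<infinity>)"

lemma (in group) mem_double_coset:
  "x \<in> double_coset G H g K \<longleftrightarrow> (\<exists>h\<in>H. \<exists>k\<in>K. x = h \<otimes> (g \<otimes> k))"
  by (auto simp: double_coset_def set_mult_def l_coset_def)

lemma (in group) dc_map_double_coset:
  assumes A: "subgroup A G" and B: "subgroup B G" and C: "subgroup C G"
    and f: "f \<in> carrier G" and g: "g \<in> carrier G" and a: "a \<in> A"
  shows "dc_map G B C f g
           (double_coset (G\<lparr>carrier := A\<rparr>) (A \<inter> conj_subgroup G B f) a (A \<inter> conj_subgroup G C g))
         = double_coset G B (f \<otimes> a \<otimes> inv g) C" (is "dc_map G B C f g ?D = ?R")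
proof -
  have ac: "a \<in> carrier G" using A a by (meson subgroup.mem_carrier)
  have Bc: "\<And>b. b \<in> B \<Longrightarrow> b \<in> carrier G" using B by (meson subgroup.mem_carrier)
  have Cc: "\<And>b. b \<in> C \<Longrightarrow> b \<in> carrier G" using C by (meson subgroup.mem_carrier)
  have oneB: "\<one> \<in> B" and oneC: "\<one> \<in> C" and oneA: "\<one> \<in> A"
    using A B C by (auto intro: subgroup.one_closed)
  have D: "x \<in> ?D \<longleftrightarrow> (\<exists>h\<in>A \<inter> conj_subgroup G B f. \<exists>k\<in>A \<inter> conj_subgroup G C g. x = h \<otimes> (a \<otimes> k))" for x
    by (auto simp: double_coset_def set_mult_def l_coset_def)
  have mem: "x \<in> dc_map G B C f g E \<longleftrightarrow> (\<exists>b\<in>B. \<exists>d\<in>E. \<exists>c\<in>C. x = b \<otimes> (f \<otimes> d \<otimes> inv g) \<otimes> c)" for x E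
    by (auto simp: dc_map_def set_mult_def l_coset_def r_coset_def)
  show ?thesis
  proof (intro equalityI subsetI)
    fix x assume "x \<in> dc_map G B C f g ?D"
    then obtain b d c where 0: "b \<in> B" "d \<in> ?D" "c \<in> C" "x = b \<otimes> (f \<otimes> d \<otimes> inv g) \<otimes> c"
      unfolding mem by blast
    then obtain h k where *: "b \<in> B" "h \<in> conj_subgroup G B f" "k \<in> conj_subgroup G C g" "c \<in> C"
        "x = b \<otimes> (f \<otimes> (h \<otimes> (a \<otimes> k)) \<otimes> inv g) \<otimes> c"
      using D[of d] by blast
    obtain b' where b': "b' \<in> B" "h = inv f \<otimes> b' \<otimes> f"
      using *(2) by (auto simp: conj_subgroup_def l_coset_def r_coset_def)
    obtain c' where c': "c' \<in> C" "k = inv g \<otimes> c' \<otimes> g"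
      using *(3) by (auto simp: conj_subgroup_def l_coset_def r_coset_def)
    have i1: "f \<otimes> (inv f \<otimes> y) = y" if "y \<in> carrier G" for y
      using that f by (simp add: m_assoc[symmetric])
    have i2: "y \<otimes> (g \<otimes> (inv g \<otimes> z)) = y \<otimes> z" if "y \<in> carrier G" "z \<in> carrier G" for y z
      using that g by (simp add: m_assoc[symmetric])
    have "x = (b \<otimes> b') \<otimes> ((f \<otimes> a \<otimes> inv g) \<otimes> (c' \<otimes> c))"
      using *(1,4) b' c' f g ac Bc Cc unfolding *(5) by (simp add: m_assoc i1 i2)
    moreover have "b \<otimes> b' \<in> B" "c' \<otimes> c \<in> C"
      using * b' c' B C by (auto intro: subgroup.m_closed)
    ultimately show "x \<in> ?R" unfolding mem_double_coset by blast
  next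
    fix x assume "x \<in> ?R"
    then obtain b c where *: "b \<in> B" "c \<in> C" "x = b \<otimes> ((f \<otimes> a \<otimes> inv g) \<otimes> c)"
      unfolding mem_double_coset by blast
    have "\<one> \<in> A \<inter> conj_subgroup G B f" "\<one> \<in> A \<inter> conj_subgroup G C g"
      using oneA oneB oneC f g
      by (auto simp: conj_subgroup_def l_coset_def r_coset_def intro!: bexI[of _ \<one>])
    hence "a \<in> ?D" unfolding D using ac by force
    moreover have "x = b \<otimes> (f \<otimes> a \<otimes> inv g) \<otimes> c"
      using * f g ac Bc Cc by (simp add: m_assoc)
    ultimately show "x \<in> dc_map G B C f g ?D" unfolding mem using * by blast
  qed
qed


section \<open>Amalgamated free products\<close>

text \<open>The pushout of homomorphisms \<open>\<phi>: L \<rightarrow> H\<close> and \<open>\<psi>: L \<rightarrow> K\<close>: words in the disjoint union of \<open>H\<close>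
  and \<open>K\<close> modulo the congruence generated by the multiplication tables of \<open>H\<close> and \<open>K\<close> and by
  \<open>\<phi> c = \<psi> c\<close>.\<close>

definition amalg_words ::
  "('a, 'm) monoid_scheme \<Rightarrow> ('b, 'n) monoid_scheme \<Rightarrow> ('a + 'b) list set" where
  "amalg_words H K = lists (Inl ` carrier H \<union> Inr ` carrier K)"

inductive_set amalg_rel ::
  "('a, 'm) monoid_scheme \<Rightarrow> ('b, 'n) monoid_scheme \<Rightarrow> ('c, 'k) monoid_scheme \<Rightarrow>
   ('c \<Rightarrow> 'a) \<Rightarrow> ('c \<Rightarrow> 'b) \<Rightarrow> (('a + 'b) list \<times> ('a + 'b) list) set"
  for H K L \<phi> \<psi> where
  multl: "x \<in> carrier H \<Longrightarrow> y \<in> carrier H \<Longrightarrow> ([Inl x, Inl y], [Inl (x \<otimes>\<^bsub>H\<^esub> y)]) \<in> amalg_rel H K L \<phi> \<psi>"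
| multr: "x \<in> carrier K \<Longrightarrow> y \<in> carrier K \<Longrightarrow> ([Inr x, Inr y], [Inr (x \<otimes>\<^bsub>K\<^esub> y)]) \<in> amalg_rel H K L \<phi> \<psi>"
| onel: "([Inl \<one>\<^bsub>H\<^esub>], []) \<in> amalg_rel H K L \<phi> \<psi>"
| oner: "([Inr \<one>\<^bsub>K\<^esub>], []) \<in> amalg_rel H K L \<phi> \<psi>"
| amalg: "c \<in> carrier L \<Longrightarrow> ([Inl (\<phi> c)], [Inr (\<psi> c)]) \<in> amalg_rel H K L \<phi> \<psi>"
| refl: "w \<in> amalg_words H K \<Longrightarrow> (w, w) \<in> amalg_rel H K L \<phi> \<psi>"
| sym: "(v, w) \<in> amalg_rel H K L \<phi> \<psi> \<Longrightarrow> (w, v) \<in> amalg_rel H K L \<phi> \<psi>"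
| trans: "(u, v) \<in> amalg_rel H K L \<phi> \<psi> \<Longrightarrow> (v, w) \<in> amalg_rel H K L \<phi> \<psi> \<Longrightarrow>
    (u, w) \<in> amalg_rel H K L \<phi> \<psi>"
| cong: "(u, u') \<in> amalg_rel H K L \<phi> \<psi> \<Longrightarrow> (v, v') \<in> amalg_rel H K L \<phi> \<psi> \<Longrightarrow>
    (u @ v, u' @ v') \<in> amalg_rel H K L \<phi> \<psi>"

definition amalg_prod ::
  "('a, 'm) monoid_scheme \<Rightarrow> ('b, 'n) monoid_scheme \<Rightarrow> ('c, 'k) monoid_scheme \<Rightarrow>
   ('c \<Rightarrow> 'a) \<Rightarrow> ('c \<Rightarrow> 'b) \<Rightarrow> ('a + 'b) list set monoid" where
  "amalg_prod H K L \<phi> \<psi> =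
     \<lparr>carrier = amalg_words H K // amalg_rel H K L \<phi> \<psi>,
      monoid.mult = (\<lambda>U Y. \<Union>u\<in>U. \<Union>v\<in>Y. amalg_rel H K L \<phi> \<psi> `` {u @ v}),
      one = amalg_rel H K L \<phi> \<psi> `` {[]}\<rparr>"

text \<open>\<open>G\<close> is the amalgamated free product of its subgroups \<open>A\<close> and \<open>B\<close> over their common subgroup \<open>C\<close>:
  the inclusions of \<open>A\<close> and \<open>B\<close> induce an isomorphism from the pushout of \<open>C \<rightarrow> A\<close> and \<open>C \<rightarrow> B\<close>
  onto \<open>G\<close>. An amalgam given by embeddings of abstract groups takes this form after \<open>A\<close>, \<open>B\<close>, \<open>C\<close> are
  replaced by their images in \<open>G\<close>.\<close>

definition amalgamated_free_product ::
  "('a, 'm) monoid_scheme \<Rightarrow> 'a set \<Rightarrow> 'a set \<Rightarrow> 'a set \<Rightarrow> bool" where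
  "amalgamated_free_product G A B C \<longleftrightarrow>
     group G \<and> subgroup A G \<and> subgroup B G \<and> subgroup C G \<and> C \<subseteq> A \<and> C \<subseteq> B \<and>
     (let H = G\<lparr>carrier := A\<rparr>; K = G\<lparr>carrier := B\<rparr>; L = G\<lparr>carrier := C\<rparr>;
          R = amalg_rel H K L id id
      in \<exists>\<theta>. \<theta> \<in> iso (amalg_prod H K L id id) G \<and>
           (\<forall>a\<in>A. \<theta> (R `` {[Inl a]}) = a) \<and> (\<forall>b\<in>B. \<theta> (R `` {[Inr b]}) = b))"

locale amalg_data =
  H: group H + K: group K + L: group L
  for H :: "('a, 'm) monoid_scheme" (structure) and K :: "('b, 'n) monoid_scheme" (structure)
    and L :: "('c, 'k) monoid_scheme" (structure) +
  fixes \<phi> :: "'c \<Rightarrow> 'a" and \<psi> :: "'c \<Rightarrow> 'b"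
  assumes \<phi>: "\<phi> \<in> hom L H" and \<psi>: "\<psi> \<in> hom L K"
begin

abbreviation "W \<equiv> amalg_words H K"
abbreviation "R \<equiv> amalg_rel H K L \<phi> \<psi>"
abbreviation "P \<equiv> amalg_prod H K L \<phi> \<psi>"

lemma W_append: "u \<in> W \<Longrightarrow> v \<in> W \<Longrightarrow> u @ v \<in> W"
  by (auto simp: amalg_words_def)

lemma R_W: "(u, v) \<in> R \<Longrightarrow> u \<in> W \<and> v \<in> W"
  by (induction rule: amalg_rel.induct)
     (use \<phi> \<psi> in \<open>auto simp: amalg_words_def hom_def\<close>)

lemma equiv_R: "equiv W R"
  by (rule equivI)
     (auto simp: refl_on_def sym_def trans_def intro: amalg_rel.refl amalg_rel.sym amalg_rel.trans dest: R_W)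

lemma class_eq: "u \<in> W \<Longrightarrow> v \<in> W \<Longrightarrow> R `` {u} = R `` {v} \<longleftrightarrow> (u, v) \<in> R"
  by (rule eq_equiv_class_iff[OF equiv_R])

lemma carrier_P: "U \<in> carrier P \<longleftrightarrow> (\<exists>w\<in>W. U = R `` {w})"
  by (auto simp: amalg_prod_def quotient_def)

lemma one_P: "\<one>\<^bsub>P\<^esub> = R `` {[]}"
  by (simp add: amalg_prod_def)

lemma mult_P:
  assumes "u \<in> W" "v \<in> W"
  shows "R `` {u} \<otimes>\<^bsub>P\<^esub> R `` {v} = R `` {u @ v}"
proof -
  have "R `` {u' @ v'} = R `` {u @ v}" if "u' \<in> R `` {u}" "v' \<in> R `` {v}" for u' v'
    by (rule equiv_class_eq[OF equiv_R, symmetric]) (use that in \<open>auto intro: amalg_rel.cong\<close>)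
  moreover have "u \<in> R `` {u}" "v \<in> R `` {v}"
    using assms by (auto intro: amalg_rel.refl)
  ultimately show ?thesis unfolding amalg_prod_def monoid.simps by blast
qed

lemma ex_left_inverse: "w \<in> W \<Longrightarrow> \<exists>v\<in>W. (v @ w, []) \<in> R"
proof (induction w)
  case Nil
  show ?case by (rule bexI[of _ "[]"]) (auto simp: amalg_words_def intro: amalg_rel.refl)
next
  case (Cons s w)
  hence w: "w \<in> W" by (simp add: amalg_words_def)
  with Cons obtain v where v: "v \<in> W" "(v @ w, []) \<in> R" by auto
  have "\<exists>t. [t] \<in> W \<and> ([t, s], []) \<in> R"
  proof (cases s)
    case (Inl x)
    with Cons.prems have x: "x \<in> carrier H" by (auto simp: amalg_words_def)
    hence "([Inl (inv\<^bsub>H\<^esub> x), Inl x], [Inl (inv\<^bsub>H\<^esub> x \<otimes>\<^bsub>H\<^esub> x)]) \<in> R" by (intro amalg_rel.multl) auto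
    hence "([Inl (inv\<^bsub>H\<^esub> x), Inl x], []) \<in> R" using x amalg_rel.onel amalg_rel.trans by fastforce
    thus ?thesis using x Inl by (intro exI[of _ "Inl (inv\<^bsub>H\<^esub> x)"]) (auto simp: amalg_words_def)
  next
    case (Inr x)
    with Cons.prems have x: "x \<in> carrier K" by (auto simp: amalg_words_def)
    hence "([Inr (inv\<^bsub>K\<^esub> x), Inr x], [Inr (inv\<^bsub>K\<^esub> x \<otimes>\<^bsub>K\<^esub> x)]) \<in> R" by (intro amalg_rel.multr) auto
    hence "([Inr (inv\<^bsub>K\<^esub> x), Inr x], []) \<in> R" using x amalg_rel.oner amalg_rel.trans by fastforce
    thus ?thesis using x Inr by (intro exI[of _ "Inr (inv\<^bsub>K\<^esub> x)"]) (auto simp: amalg_words_def)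
  qed
  then obtain t where t: "[t] \<in> W" "([t, s], []) \<in> R" by blast
  have "([t, s] @ w, [] @ w) \<in> R" using t w by (intro amalg_rel.cong amalg_rel.refl)
  hence "(v @ ([t, s] @ w), v @ ([] @ w)) \<in> R" using v by (blast intro: amalg_rel.cong amalg_rel.refl)
  hence "((v @ [t]) @ s # w, []) \<in> R" using v(2) amalg_rel.trans by fastforce
  thus ?case using W_append[OF v(1) t(1)] by blast
qed

theorem group_P: "group P"
proof (rule groupI)
  have nil: "[] \<in> W" by (simp add: amalg_words_def)
  show "\<one>\<^bsub>P\<^esub> \<in> carrier P" using nil by (auto simp: carrier_P one_P)
  show "U \<otimes>\<^bsub>P\<^esub> Y \<in> carrier P" if "U \<in> carrier P" "Y \<in> carrier P" for U Y
    using that by (auto simp: carrier_P mult_P intro: W_append)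
  show "U \<otimes>\<^bsub>P\<^esub> Y \<otimes>\<^bsub>P\<^esub> Z = U \<otimes>\<^bsub>P\<^esub> (Y \<otimes>\<^bsub>P\<^esub> Z)"
    if "U \<in> carrier P" "Y \<in> carrier P" "Z \<in> carrier P" for U Y Z
    using that by (auto simp: carrier_P mult_P W_append)
  show "\<one>\<^bsub>P\<^esub> \<otimes>\<^bsub>P\<^esub> U = U" if "U \<in> carrier P" for U
    using that nil by (auto simp: carrier_P mult_P one_P)
  show "\<exists>Y\<in>carrier P. Y \<otimes>\<^bsub>P\<^esub> U = \<one>\<^bsub>P\<^esub>" if U: "U \<in> carrier P" for U
  proof -
    obtain w where w: "w \<in> W" "U = R `` {w}" using U carrier_P by auto
    obtain v where v: "v \<in> W" "(v @ w, []) \<in> R" using ex_left_inverse[OF w(1)] by blast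
    have "R `` {v} \<otimes>\<^bsub>P\<^esub> U = \<one>\<^bsub>P\<^esub>"
      using v w nil by (simp add: mult_P one_P class_eq W_append)
    thus ?thesis using v carrier_P by blast
  qed
qed

lemma hom_left: "(\<lambda>x. R `` {[Inl x]}) \<in> hom H P"
proof (rule homI)
  have w: "[Inl x] \<in> W" if "x \<in> carrier H" for x using that by (simp add: amalg_words_def)
  show "R `` {[Inl x]} \<in> carrier P" if "x \<in> carrier H" for x
    using w[OF that] carrier_P by blast
  show "R `` {[Inl (x \<otimes>\<^bsub>H\<^esub> y)]} = R `` {[Inl x]} \<otimes>\<^bsub>P\<^esub> R `` {[Inl y]}"
    if "x \<in> carrier H" "y \<in> carrier H" for x y
    using that equiv_class_eq[OF equiv_R amalg_rel.multl[OF that]] by (simp add: mult_P w)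
qed

lemma hom_right: "(\<lambda>x. R `` {[Inr x]}) \<in> hom K P"
proof (rule homI)
  have w: "[Inr x] \<in> W" if "x \<in> carrier K" for x using that by (simp add: amalg_words_def)
  show "R `` {[Inr x]} \<in> carrier P" if "x \<in> carrier K" for x
    using w[OF that] carrier_P by blast
  show "R `` {[Inr (x \<otimes>\<^bsub>K\<^esub> y)]} = R `` {[Inr x]} \<otimes>\<^bsub>P\<^esub> R `` {[Inr y]}"
    if "x \<in> carrier K" "y \<in> carrier K" for x y
    using that equiv_class_eq[OF equiv_R amalg_rel.multr[OF that]] by (simp add: mult_P w)
qed

lemma class_amalg: "c \<in> carrier L \<Longrightarrow> R `` {[Inl (\<phi> c)]} = R `` {[Inr (\<psi> c)]}"
  by (rule equiv_class_eq[OF equiv_R]) (rule amalg_rel.amalg)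

theorem universal:
  fixes Q :: "('d, 'q) monoid_scheme" (structure)
  assumes Q: "group Q" and f: "f \<in> hom H Q" and g: "g \<in> hom K Q"
    and fg: "\<And>c. c \<in> carrier L \<Longrightarrow> f (\<phi> c) = g (\<psi> c)"
  obtains h where "h \<in> hom P Q" "\<And>x. x \<in> carrier H \<Longrightarrow> h (R `` {[Inl x]}) = f x"
    "\<And>x. x \<in> carrier K \<Longrightarrow> h (R `` {[Inr x]}) = g x"
proof -
  interpret Q: group Q by (rule Q)
  define ev where "ev w = foldr (\<lambda>s y. case_sum f g s \<otimes>\<^bsub>Q\<^esub> y) w \<one>\<^bsub>Q\<^esub>" for w
  define h where "h U = ev (SOME w. w \<in> U)" for U
  have f_c [simp]: "f x \<in> carrier Q" if "x \<in> carrier H" for x using f that by (auto simp: hom_def)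
  have g_c [simp]: "g x \<in> carrier Q" if "x \<in> carrier K" for x using g that by (auto simp: hom_def)
  have f1: "f \<one>\<^bsub>H\<^esub> = \<one>\<^bsub>Q\<^esub>" by (rule hom_one[OF f H.is_group Q])
  have g1: "g \<one>\<^bsub>K\<^esub> = \<one>\<^bsub>Q\<^esub>" by (rule hom_one[OF g K.is_group Q])
  have ev_c [simp]: "ev w \<in> carrier Q" if "w \<in> W" for w
    using that by (induction w) (auto simp: ev_def amalg_words_def)
  have ev_app: "ev (u @ v) = ev u \<otimes>\<^bsub>Q\<^esub> ev v" if "u \<in> W" "v \<in> W" for u v
    using that(1)
  proof (induction u)
    case (Cons s u)
    hence u: "u \<in> W" and s: "case_sum f g s \<in> carrier Q" by (auto simp: amalg_words_def)
    have "ev ((s # u) @ v) = case_sum f g s \<otimes>\<^bsub>Q\<^esub> ev (u @ v)" by (simp add: ev_def)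
    also have "\<dots> = case_sum f g s \<otimes>\<^bsub>Q\<^esub> (ev u \<otimes>\<^bsub>Q\<^esub> ev v)" using Cons.IH[OF u] by simp
    also have "\<dots> = (case_sum f g s \<otimes>\<^bsub>Q\<^esub> ev u) \<otimes>\<^bsub>Q\<^esub> ev v"
      using u s that(2) by (simp add: Q.m_assoc)
    also have "\<dots> = ev (s # u) \<otimes>\<^bsub>Q\<^esub> ev v" by (simp add: ev_def)
    finally show ?case .
  qed (use ev_c[OF that(2)] in \<open>simp add: ev_def\<close>)
  have \<phi>_c: "\<phi> c \<in> carrier H" and \<psi>_c: "\<psi> c \<in> carrier K" if "c \<in> carrier L" for c
    using \<phi> \<psi> that by (auto simp: hom_def)
  have ev_R: "ev u = ev v" if "(u, v) \<in> R" for u v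
    using that
  proof (induction rule: amalg_rel.induct)
    case (multl x y) thus ?case using f by (simp add: ev_def hom_mult)
  next
    case (multr x y) thus ?case using g by (simp add: ev_def hom_mult)
  next
    case (cong u u' v v') thus ?case using R_W by (simp add: ev_app)
  qed (auto simp: ev_def f1 g1 fg)
  have h_class: "h (R `` {w}) = ev w" if "w \<in> W" for w
  proof -
    have "w \<in> R `` {w}" using that by (auto intro: amalg_rel.refl)
    hence "(SOME v. v \<in> R `` {w}) \<in> R `` {w}" by (rule someI)
    thus ?thesis unfolding h_def using ev_R by auto
  qed
  show thesis
  proof (rule that[of h])
    show "h \<in> hom P Q"
      by (rule homI) (auto simp: carrier_P mult_P h_class ev_app W_append)
  qed (auto simp: h_class amalg_words_def ev_def)
qed

end

end

theory Submission
  imports Defs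
begin

text \<open>If \<open>G\<close> has the f.g.i.p., it has the f.g.i.p. relative to \<open>C\<close> because \<open>C\<close> is finitely generated. For the converse, let \<open>H\<close> and \<open>K\<close> be
finitely generated subgroups of \<open>G = A *\<^sub>C B\<close>, and consider the Bass-Serre tree, whose edges are the
left cosets of \<open>C\<close> and whose vertices are the left cosets of \<open>A\<close> and of \<open>B\<close>. Each of \<open>H\<close>, \<open>K\<close> acts with
finitely many orbits of edges on a subtree through the edge \<open>C\<close> (\<open>ex_connected_hull\<close>); the two subtrees
meet in a subtree \<open>Z\<close> (\<open>connected_in_inter\<close>), on which \<open>J = H \<inter> K\<close> acts, possibly with infinitely many
orbits of edges.

The \<open>A\<close>-vertices of \<open>Z\<close> are controlled by the hypotheses on \<open>(A, C)\<close>. Over a fixed pair of an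
\<open>H\<close>-orbit and a \<open>K\<close>-orbit of \<open>A\<close>-vertices, the \<open>J\<close>-orbits of \<open>A\<close>-vertices of \<open>Z\<close> correspond to certain
double cosets in \<open>A\<close> of two vertex stabilisers, and the edges at such a vertex, modulo its stabiliser in \<open>J\<close>, to
the elements of the fibres of the maps \<open>q\<close> in the f.c.i.p. Hence for all but finitely many orbits there is
at most one such edge, and there are never infinitely many. By the \<open>C\<close>-f.g.i.p., for all but finitely
many orbits the stabiliser in \<open>J\<close> of the vertex fixes that edge. So all but finitely many orbits of
\<open>A\<close>-vertices of \<open>Z\<close> consist of leaves, and the remaining \<open>A\<close>-vertices lie on only finitely many orbits of
edges (\<open>finite_branching\<close>). Cutting off the leaves leaves a subtree (\<open>connected_in_prune\<close>) on which
\<open>J\<close> acts with finitely many orbits of edges. Its vertex stabilisers are intersections of vertex stabilisers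
for \<open>H\<close> and \<open>K\<close>, hence finitely generated because \<open>A\<close> and \<open>B\<close> have the f.g.i.p., so \<open>J\<close> is
finitely generated (\<open>fg_of_cofinite_action\<close>).

This needs finitely generated vertex stabilisers for \<open>H\<close> and \<open>K\<close>; that is where the f.g.i.p. of
\<open>G\<close> relative to \<open>C\<close> enters, since a finitely generated group acting on a tree with finitely many orbits of
edges and finitely generated edge stabilisers has finitely generated vertex stabilisers
(\<open>fg_inter_factor\<close>). That result and the connectedness of \<open>Z\<close> are the two uses of the tree property, in
the form that a connected graph mapped locally injectively to a tree is mapped injectively
(\<open>locally_injective_imp_injective\<close>).

Throughout, a subgraph of the tree is given by its edges, that is by a set \<open>U\<close> of elements of \<open>G\<close> that is
closed under right multiplication by \<open>C\<close>. Two elements are adjacent when they lie in the same left coset of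
\<open>A\<close> or of \<open>B\<close>. The two factors form a family \<open>S\<close> indexed by \<open>bool\<close>, so that \<open>S (\<not> s)\<close> is the factor other
than \<open>S s\<close>.\<close>

section \<open>Finitely generated subgroups and sums of extended naturals\<close>

context group
begin

lemma inv_cancel_left [simp]:
  "x \<in> carrier G \<Longrightarrow> y \<in> carrier G \<Longrightarrow> inv x \<otimes> (x \<otimes> y) = y"
  "x \<in> carrier G \<Longrightarrow> y \<in> carrier G \<Longrightarrow> x \<otimes> (inv x \<otimes> y) = y"
  by (simp_all add: m_assoc[symmetric])

lemmas group_norm = m_assoc inv_mult_group

lemma mem_conj_subgroup:
  assumes "H \<subseteq> carrier G" "x \<in> carrier G"
  shows "z \<in> conj_subgroup G H x \<longleftrightarrow> z \<in> carrier G \<and> x \<otimes> z \<otimes> inv x \<in> H" (is "?l \<longleftrightarrow> ?r")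
proof
  assume ?l
  then obtain h where "h \<in> H" "z = inv x \<otimes> h \<otimes> x"
    by (auto simp: conj_subgroup_def l_coset_def r_coset_def)
  with assms show ?r by (auto simp: group_norm subsetD)
next
  assume r: ?r
  hence "z = inv x \<otimes> (x \<otimes> z \<otimes> inv x) \<otimes> x" using assms by (simp add: group_norm)
  with r show ?l by (auto simp: conj_subgroup_def l_coset_def r_coset_def)
qed

lemma conj_subgroup_image: "conj_subgroup G H x = (\<lambda>h. inv x \<otimes> h \<otimes> x) ` H"
  by (auto simp: conj_subgroup_def l_coset_def r_coset_def)

lemma conjugation_hom: "x \<in> carrier G \<Longrightarrow> group_hom G G (\<lambda>h. inv x \<otimes> h \<otimes> x)"
  by (rule group_hom.intro[OF is_group is_group])
     (auto simp: group_hom_axioms_def hom_def group_norm)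

lemma subgroup_conj_subgroup:
  "subgroup H G \<Longrightarrow> x \<in> carrier G \<Longrightarrow> subgroup (conj_subgroup G H x) G"
  unfolding conj_subgroup_image
  by (rule group_hom.subgroup_img_is_subgroup[OF conjugation_hom])

lemma conj_subgroup_subset: "H \<subseteq> carrier G \<Longrightarrow> x \<in> carrier G \<Longrightarrow> conj_subgroup G H x \<subseteq> carrier G"
  by (auto simp: mem_conj_subgroup)

lemma fg_conj_subgroup:
  assumes "fg_subgroup H G" "x \<in> carrier G"
  shows "fg_subgroup (conj_subgroup G H x) G"
proof -
  obtain T where T: "finite T" "T \<subseteq> carrier G" "H = generate G T"
    using assms by (auto simp: fg_subgroup_def)
  have "conj_subgroup G H x = generate G ((\<lambda>h. inv x \<otimes> h \<otimes> x) ` T)"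
    using group_hom.generate_img[OF conjugation_hom[OF assms(2)] T(2)] T(3)
    by (simp add: conj_subgroup_image)
  thus ?thesis using T assms(2) unfolding fg_subgroup_def
    by (intro exI[of _ "(\<lambda>h. inv x \<otimes> h \<otimes> x) ` T"]) auto
qed

lemma fg_subgroup_imp_subgroup: "fg_subgroup H G \<Longrightarrow> subgroup H G"
  by (auto simp: fg_subgroup_def intro: generate_is_subgroup)

lemma fg_subgroup_carrier_iff:
  assumes "subgroup A G"
  shows "fg_subgroup H (G\<lparr>carrier := A\<rparr>) \<longleftrightarrow> fg_subgroup H G \<and> H \<subseteq> A"
proof
  assume "fg_subgroup H (G\<lparr>carrier := A\<rparr>)"
  then obtain T where "finite T" "T \<subseteq> A" "H = generate (G\<lparr>carrier := A\<rparr>) T"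
    by (auto simp: fg_subgroup_def)
  thus "fg_subgroup H G \<and> H \<subseteq> A"
    using assms generate_consistent[of T A] generate_subgroup_incl[of T A] subgroup.subset[OF assms]
    by (auto simp: fg_subgroup_def intro!: exI[of _ T])
next
  assume "fg_subgroup H G \<and> H \<subseteq> A"
  then obtain T where "finite T" "T \<subseteq> A" "H = generate G T"
    by (auto simp: fg_subgroup_def intro: generate.incl)
  thus "fg_subgroup H (G\<lparr>carrier := A\<rparr>)"
    using assms generate_consistent[of T A] by (auto simp: fg_subgroup_def)
qed

lemma conj_subgroup_carrier_update:
  assumes "subgroup A G" "x \<in> A"
  shows "conj_subgroup (G\<lparr>carrier := A\<rparr>) H x = conj_subgroup G H x"
  using assms by (simp add: conj_subgroup_def l_coset_def r_coset_def m_inv_consistent)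

end

lemma double_coset_carrier_update [simp]:
  "double_coset (M\<lparr>carrier := A\<rparr>) = double_coset M"
  by (simp add: double_coset_def l_coset_def set_mult_def fun_eq_iff)

lemma (in group) double_coset_eqI:
  assumes H: "subgroup H G" and K: "subgroup K G" and g: "g \<in> carrier G"
    and x: "x \<in> double_coset G H g K"
  shows "double_coset G H x K = double_coset G H g K"
proof -
  interpret H: subgroup H G by (rule H)
  interpret K: subgroup K G by (rule K)
  obtain h k where hk: "h \<in> H" "k \<in> K" "x = h \<otimes> (g \<otimes> k)"
    using x by (auto simp: mem_double_coset)
  show ?thesis
  proof (intro equalityI subsetI)
    fix y assume "y \<in> double_coset G H x K"
    then obtain h' k' where *: "h' \<in> H" "k' \<in> K" "y = h' \<otimes> (x \<otimes> k')"
      by (auto simp: mem_double_coset)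
    hence "y = (h' \<otimes> h) \<otimes> (g \<otimes> (k \<otimes> k'))" using hk g by (simp add: m_assoc)
    thus "y \<in> double_coset G H g K" unfolding mem_double_coset using * hk by blast
  next
    fix y assume "y \<in> double_coset G H g K"
    then obtain h' k' where *: "h' \<in> H" "k' \<in> K" "y = h' \<otimes> (g \<otimes> k')"
      by (auto simp: mem_double_coset)
    hence "y = (h' \<otimes> inv h) \<otimes> (x \<otimes> (inv k \<otimes> k'))" using hk g by (simp add: m_assoc)
    thus "y \<in> double_coset G H x K" unfolding mem_double_coset using * hk by blast
  qed
qed

lemma (in group) double_coset_self:
  "subgroup H G \<Longrightarrow> subgroup K G \<Longrightarrow> g \<in> carrier G \<Longrightarrow> g \<in> double_coset G H g K"
  unfolding mem_double_coset
  by (rule bexI[of _ \<one>], rule bexI[of _ \<one>]) (auto simp: subgroup.one_closed)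

lemma infsum_enat_finite:
  fixes f :: "'a \<Rightarrow> enat"
  assumes "infsum f V < \<infinity>"
  shows "finite {x \<in> V. f x \<noteq> 0}" and "\<And>x. x \<in> V \<Longrightarrow> f x < \<infinity>"
proof -
  obtain n where n: "infsum f V = enat n" using assms by auto
  have le: "sum f F \<le> enat n" if "finite F" "F \<subseteq> V" for F
    using that unfolding n[symmetric] by (subst nonneg_infsum_complete) (auto intro: SUP_upper)
  show "f x < \<infinity>" if "x \<in> V" for x
    using le[of "{x}"] that by (cases "f x") auto
  show "finite {x \<in> V. f x \<noteq> 0}"
  proof (rule ccontr)
    assume "infinite {x \<in> V. f x \<noteq> 0}"
    then obtain F where F: "F \<subseteq> {x \<in> V. f x \<noteq> 0}" "finite F" "card F = Suc n"
      using infinite_arbitrarily_large by blast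
    have "enat (Suc n) = (\<Sum>x\<in>F. 1)" using F by (simp add: of_nat_eq_enat)
    also have "\<dots> \<le> sum f F"
      by (rule sum_mono) (use F in \<open>auto simp: one_eSuc i0_less intro!: ileI1\<close>)
    also have "\<dots> \<le> enat n" using le F by auto
    finally show False by simp
  qed
qed

section \<open>Normal forms in an amalgamated product\<close>

text \<open>A word is reduced when its letters lie outside \<open>C\<close> and alternate between the two factors, starting with
the factor \<open>S s\<close>. These words label the paths without backtracking in the tree.\<close>

fun reduced :: "(bool \<Rightarrow> 'a set) \<Rightarrow> 'a set \<Rightarrow> bool \<Rightarrow> 'a list \<Rightarrow> bool" where
  "reduced S C s [] \<longleftrightarrow> True"
| "reduced S C s (x # w) \<longleftrightarrow> x \<in> S s - C \<and> reduced S C (\<not> s) w"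

definition word_prod :: "('a, 'm) monoid_scheme \<Rightarrow> 'a list \<Rightarrow> 'a" where
  "word_prod G w = foldr (monoid.mult G) w (one G)"

lemma word_prod_simps [simp]:
  "word_prod G [] = \<one>\<^bsub>G\<^esub>" "word_prod G (x # w) = x \<otimes>\<^bsub>G\<^esub> word_prod G w"
  by (simp_all add: word_prod_def)

text \<open>The normal form property is the only consequence of the universal property that is used later, besides
generation by the factors. Both are symmetric in the two factors.\<close>

locale amalgam = group G for G :: "('a, 'm) monoid_scheme" (structure) +
  fixes S :: "bool \<Rightarrow> 'a set" and C :: "'a set"
  assumes subS: "subgroup (S s) G" and subC: "subgroup C G" and C_S: "C \<subseteq> S s"
    and gen: "generate G (S True \<union> S False) = carrier G"
    and normal_form: "reduced S C s w \<Longrightarrow> w \<noteq> [] \<Longrightarrow> word_prod G w \<noteq> \<one>"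

text \<open>To detect that a reduced word is not trivial, the pushout is made to act on the lists of subsets of \<open>G\<close>
without equal neighbours. The lists that occur are the paths without backtracking in the tree that start at the
vertex \<open>A\<close>, recorded by their edges. An element of \<open>A\<close> fixes that starting vertex, so it acts by translation.
An element of \<open>B\<close> fixes the vertex \<open>B\<close>; the paths starting there are those starting at \<open>A\<close> with
the edge \<open>C\<close> added at the front, or removed if it is there already. So it acts by translation conjugated with
this operation, which is the involution \<open>toggle C\<close>. The two actions agree on \<open>C\<close>, because \<open>C\<close> fixes
the edge \<open>C\<close>. No transversals of \<open>C\<close> have to be chosen.\<close>

definition edge_paths :: "('a, 'm) monoid_scheme \<Rightarrow> 'a set list set" where
  "edge_paths G = {p. distinct_adj p \<and> set p \<subseteq> Pow (carrier G)}"

definition toggle :: "'a \<Rightarrow> 'a list \<Rightarrow> 'a list" where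
  "toggle e p = (if p \<noteq> [] \<and> hd p = e then tl p else e # p)"

definition translate :: "('a, 'm) monoid_scheme \<Rightarrow> 'a \<Rightarrow> 'a set list \<Rightarrow> 'a set list" where
  "translate G x = map (\<lambda>e. x <#\<^bsub>G\<^esub> e)"

definition letter_act :: "('a, 'm) monoid_scheme \<Rightarrow> 'a set \<Rightarrow> 'a + 'a \<Rightarrow> 'a set list \<Rightarrow> 'a set list" where
  "letter_act G C l =
     (case l of Inl a \<Rightarrow> translate G a | Inr b \<Rightarrow> toggle C \<circ> translate G b \<circ> toggle C)"

lemma toggle_toggle: "p \<in> edge_paths G \<Longrightarrow> toggle e (toggle e p) = p"
  by (cases p; cases "tl p") (auto simp: toggle_def edge_paths_def distinct_adj_Cons)

lemma toggle_paths: "p \<in> edge_paths G \<Longrightarrow> e \<subseteq> carrier G \<Longrightarrow> toggle e p \<in> edge_paths G"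
  by (cases p) (auto simp: toggle_def edge_paths_def distinct_adj_Cons)

context group
begin

lemma lcos_inj:
  assumes "x \<in> carrier G" "e \<subseteq> carrier G" "f \<subseteq> carrier G"
  shows "x <#\<^bsub>G\<^esub> e = x <#\<^bsub>G\<^esub> f \<longleftrightarrow> e = f"
  using assms lcos_m_assoc[of e "inv x" x] lcos_m_assoc[of f "inv x" x] lcos_mult_one[of e] lcos_mult_one[of f]
  by (metis inv_closed l_inv)

lemma translate_paths: "x \<in> carrier G \<Longrightarrow> p \<in> edge_paths G \<Longrightarrow> translate G x p \<in> edge_paths G"
proof -
  assume x: "x \<in> carrier G" and p: "p \<in> edge_paths G"
  have "inj_on (\<lambda>e. x <#\<^bsub>G\<^esub> e) (set p)"
  proof (rule inj_onI)
    fix e f assume ef: "e \<in> set p" "f \<in> set p" "x <#\<^bsub>G\<^esub> e = x <#\<^bsub>G\<^esub> f"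
    hence "e \<subseteq> carrier G" "f \<subseteq> carrier G" using p by (auto simp: edge_paths_def)
    thus "e = f" using lcos_inj x ef by blast
  qed
  moreover have "x <#\<^bsub>G\<^esub> e \<subseteq> carrier G" if "e \<in> set p" for e
    using x p that by (intro l_coset_subset_G) (auto simp: edge_paths_def)
  ultimately show ?thesis using p by (auto simp: edge_paths_def translate_def intro!: distinct_adj_mapI)
qed

lemma translate_mult:
  "x \<in> carrier G \<Longrightarrow> y \<in> carrier G \<Longrightarrow> p \<in> edge_paths G \<Longrightarrow>
     translate G x (translate G y p) = translate G (x \<otimes> y) p"
  by (auto simp: edge_paths_def translate_def lcos_m_assoc)

lemma translate_one: "p \<in> edge_paths G \<Longrightarrow> translate G \<one> p = p"
  by (auto simp: edge_paths_def translate_def lcos_mult_one intro!: map_idI)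

lemma lcos_self_iff:
  assumes "subgroup C G" "x \<in> carrier G"
  shows "x <#\<^bsub>G\<^esub> C = C \<longleftrightarrow> x \<in> C"
proof
  assume "x <#\<^bsub>G\<^esub> C = C"
  moreover have "x \<otimes> \<one> \<in> x <#\<^bsub>G\<^esub> C"
    using subgroup.one_closed[OF assms(1)] unfolding l_coset_def by blast
  ultimately show "x \<in> C" using assms by simp
qed (use assms coset_join3 in blast)

lemma toggle_translate:
  assumes "subgroup C G" "c \<in> C" "p \<in> edge_paths G"
  shows "toggle C (translate G c p) = translate G c (toggle C p)"
proof -
  have c: "c \<in> carrier G" "C \<subseteq> carrier G" using assms by (auto dest: subgroup.subset)
  have cC: "c <#\<^bsub>G\<^esub> C = C" using lcos_self_iff assms c by blast
  show ?thesis
  proof (cases p)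
    case (Cons e q)
    hence "c <#\<^bsub>G\<^esub> e = C \<longleftrightarrow> e = C"
      using lcos_inj[of c e C] assms c cC by (auto simp: edge_paths_def)
    thus ?thesis using Cons cC by (auto simp: toggle_def translate_def)
  qed (simp add: toggle_def translate_def cC)
qed

lemma letter_act_paths:
  assumes "subgroup C G" "l \<in> Inl ` carrier G \<union> Inr ` carrier G" "p \<in> edge_paths G"
  shows "letter_act G C l p \<in> edge_paths G"
  using assms subgroup.subset[OF assms(1)]
  by (auto simp: letter_act_def intro!: translate_paths toggle_paths)

end

fun letters :: "bool \<Rightarrow> 'a list \<Rightarrow> ('a + 'a) list" where
  "letters s [] = []"
| "letters s (x # w) = (if s then Inl x else Inr x) # letters (\<not> s) w"

lemma map_letters: "map (case_sum id id) (letters s w) = w"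
  by (induction w arbitrary: s) auto

lemma letters_words:
  "reduced (\<lambda>s. if s then A else B) C s w \<Longrightarrow>
     letters s w \<in> amalg_words (G\<lparr>carrier := A\<rparr>) (G\<lparr>carrier := B\<rparr>)"
  by (induction w arbitrary: s) (auto simp: amalg_words_def split: if_splits)

text \<open>When a reduced word is applied letter by letter from the right, each letter prepends an edge. The starting path is
the one that the last letter does not fix: \<open>[C]\<close> for a letter in \<open>A\<close> and \<open>[]\<close> for a letter in \<open>B\<close>. The
result differs from both starting paths.\<close>

lemma (in group) reduced_act:
  assumes "subgroup A G" "subgroup B G" "subgroup C G"
    and "reduced (\<lambda>s. if s then A else B) C s w" "w \<noteq> []"
  shows "\<exists>p0\<in>{[], [C]}. \<exists>p. p = foldr (letter_act G C) (letters s w) p0 \<and>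
           p \<noteq> [] \<and> (if s then hd p \<noteq> C else hd p = C \<and> 2 \<le> length p)"
  using assms(4,5)
proof (induction w arbitrary: s)
  case (Cons x w)
  have x: "x \<in> carrier G" "x <#\<^bsub>G\<^esub> C \<noteq> C"
    using Cons.prems assms subgroup.subset lcos_self_iff[of C x] by (fastforce split: if_splits)+
  show ?case
  proof (cases "w = []")
    case True
    show ?thesis
    proof (cases s)
      case t: True
      show ?thesis by (rule bexI[of _ "[C]"]) (use t True x in \<open>auto simp: letter_act_def translate_def\<close>)
    next
      case f: False
      show ?thesis by (rule bexI[of _ "[]"]) (use f True x in \<open>auto simp: letter_act_def translate_def toggle_def\<close>)
    qed
  next
    case False
    then obtain p0 where p0: "p0 \<in> {[], [C]}" "\<exists>p. p = foldr (letter_act G C) (letters (\<not> s) w) p0 \<and>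
           p \<noteq> [] \<and> (if \<not> s then hd p \<noteq> C else hd p = C \<and> 2 \<le> length p)"
      using Cons.IH[of "\<not> s"] Cons.prems by auto
    then obtain e q where p: "e # q = foldr (letter_act G C) (letters (\<not> s) w) p0"
      "if \<not> s then e \<noteq> C else e = C"
      by (metis list.collapse)
    let ?l = "if s then Inl x else Inr x"
    have eq: "foldr (letter_act G C) (letters s (x # w)) p0 = letter_act G C ?l (e # q)"
      using p(1) by simp
    have "letter_act G C ?l (e # q) \<noteq> [] \<and>
        (if s then hd (letter_act G C ?l (e # q)) \<noteq> C
         else hd (letter_act G C ?l (e # q)) = C \<and> 2 \<le> length (letter_act G C ?l (e # q)))"
      using p(2) x by (cases s) (auto simp: letter_act_def translate_def toggle_def)
    thus ?thesis unfolding eq[symmetric] using p0(1) by blast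
  qed
qed simp

text \<open>The action on paths respects the defining relations of the pushout, by induction on the congruence. So a reduced
word with product \<open>\<one>\<close> would act like the empty word, contrary to \<open>reduced_act\<close>.\<close>

theorem amalgamated_free_product_imp_amalgam:
  fixes G :: "('a, 'm) monoid_scheme" (structure)
  assumes "amalgamated_free_product G A B C"
  shows "amalgam G (\<lambda>s. if s then A else B) C"
proof -
  let ?H = "G\<lparr>carrier := A\<rparr>" and ?K = "G\<lparr>carrier := B\<rparr>" and ?L = "G\<lparr>carrier := C\<rparr>"
  let ?S = "\<lambda>s. if s then A else B"
  have G: "group G" and A: "subgroup A G" and B: "subgroup B G" and C: "subgroup C G"
    and CA: "C \<subseteq> A" and CB: "C \<subseteq> B"
    using assms by (auto simp: amalgamated_free_product_def)
  interpret group G by (rule G)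
  \<comment> \<open>An opaque copy of the identity keeps the parameters of the pushout stable under simplification.\<close>
  define \<iota> :: "'a \<Rightarrow> 'a" where "\<iota> = id"
  have \<iota>: "\<iota> c = c" for c by (simp add: \<iota>_def)
  interpret amalg_data ?H ?K ?L \<iota> \<iota>
    by (intro amalg_data.intro amalg_data_axioms.intro subgroup_imp_group A B C)
       (use CA CB in \<open>auto simp: hom_def \<iota>\<close>)
  obtain \<theta> where \<theta>: "\<theta> \<in> iso P G" "\<And>a. a \<in> A \<Longrightarrow> \<theta> (R `` {[Inl a]}) = a"
    "\<And>b. b \<in> B \<Longrightarrow> \<theta> (R `` {[Inr b]}) = b"
    using assms unfolding amalgamated_free_product_def Let_def \<iota>_def by blast
  have hom: "\<theta> \<in> hom P G" and bij: "bij_betw \<theta> (carrier P) (carrier G)"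
    using \<theta>(1) by (auto simp: iso_def)
  have Ac: "A \<subseteq> carrier G" and Bc: "B \<subseteq> carrier G" and Cc: "C \<subseteq> carrier G"
    using A B C by (auto dest: subgroup.subset)
  have eval: "\<theta> (R `` {w}) = word_prod G (map (case_sum id id) w)" if "w \<in> W" for w
    using that
  proof (induction w)
    case Nil
    show ?case using hom_one[OF hom group_P is_group] by (simp add: one_P)
  next
    case (Cons l w)
    hence w: "w \<in> W" "[l] \<in> W" by (auto simp: amalg_words_def)
    have "\<theta> (R `` {[l] @ w}) = \<theta> (R `` {[l]} \<otimes>\<^bsub>P\<^esub> R `` {w})" using w by (simp only: mult_P)
    also have "\<dots> = \<theta> (R `` {[l]}) \<otimes> \<theta> (R `` {w})"
      using hom w by (intro hom_mult[OF hom]) (auto simp: carrier_P)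
    also have "\<theta> (R `` {[l]}) = case_sum id id l"
      using w(2) \<theta>(2,3) by (auto simp: amalg_words_def)
    finally show ?case using Cons.IH w by simp
  qed
  have act_R: "foldr (letter_act G C) u p = foldr (letter_act G C) v p"
    if "(u, v) \<in> R" "p \<in> edge_paths G" for u v p
    using that
  proof (induction arbitrary: p rule: amalg_rel.induct)
    case (multl x y)
    hence "x \<in> carrier G" "y \<in> carrier G" using Ac by auto
    thus ?case using multl by (simp add: letter_act_def translate_mult)
  next
    case (multr x y)
    hence xy: "x \<in> carrier G" "y \<in> carrier G" using Bc by auto
    have "toggle C p \<in> edge_paths G" using multr Cc by (blast intro: toggle_paths)
    moreover have "translate G y (toggle C p) \<in> edge_paths G"
      using calculation xy by (blast intro: translate_paths)
    ultimately show ?case using xy by (simp add: letter_act_def translate_mult toggle_toggle)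
  next
    case onel
    thus ?case by (simp add: letter_act_def translate_one)
  next
    case oner
    moreover have "toggle C p \<in> edge_paths G" using oner Cc by (blast intro: toggle_paths)
    ultimately show ?case by (simp add: letter_act_def translate_one toggle_toggle)
  next
    case (amalg c)
    hence "translate G c p \<in> edge_paths G" using Cc by (auto intro: translate_paths)
    thus ?case using amalg C
      by (simp add: letter_act_def toggle_translate[symmetric] toggle_toggle \<iota>)
  next
    case (cong u u' v v')
    have "v \<in> W" using R_W cong.hyps by blast
    hence "foldr (letter_act G C) v p \<in> edge_paths G"
      using cong.prems
    proof (induction v)
      case (Cons l v)
      hence "foldr (letter_act G C) v p \<in> edge_paths G" by (auto simp: amalg_words_def)
      moreover have "l \<in> Inl ` carrier G \<union> Inr ` carrier G"
        using Cons Ac Bc by (auto simp: amalg_words_def)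
      ultimately show ?case using letter_act_paths[OF C] by simp
    qed simp
    thus ?case using cong by simp
  qed auto
  show ?thesis
  proof (intro amalgam.intro amalgam_axioms.intro)
    show "group G" by (rule G)
    show "subgroup (?S s) G" "C \<subseteq> ?S s" for s using A B CA CB by auto
    show "subgroup C G" by (rule C)
    show "generate G (?S True \<union> ?S False) = carrier G"
    proof
      show "generate G (?S True \<union> ?S False) \<subseteq> carrier G"
        using Ac Bc generate_incl[of "A \<union> B"] by simp
      show "carrier G \<subseteq> generate G (?S True \<union> ?S False)"
      proof
        fix g assume "g \<in> carrier G"
        then obtain U where U: "U \<in> carrier P" "g = \<theta> U"
          using bij unfolding bij_betw_def by blast
        from U(1) obtain w where w: "w \<in> W" "U = R `` {w}" unfolding carrier_P by (rule bexE)
        have "word_prod G (map (case_sum id id) w) \<in> generate G (A \<union> B)"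
          using w(1)
        proof (induction w)
          case (Cons l w)
          hence "case_sum id id l \<in> generate G (A \<union> B)"
            by (auto simp: amalg_words_def intro: generate.incl)
          thus ?case using Cons by (auto simp: amalg_words_def intro: generate.eng)
        qed (simp add: generate.one)
        thus "g \<in> generate G (?S True \<union> ?S False)" using eval[OF w(1)] w(2) U(2) by simp
      qed
    qed
    show "word_prod G w \<noteq> \<one>" if w: "reduced ?S C s w" "w \<noteq> []" for s w
    proof
      assume one: "word_prod G w = \<one>"
      have W: "letters s w \<in> W" "[] \<in> W"
        using letters_words[OF w(1)] by (auto simp: amalg_words_def)
      have "\<theta> (R `` {letters s w}) = \<theta> (R `` {[]})"
        using eval[OF W(1)] eval[OF W(2)] one by (simp add: map_letters)
      moreover have "R `` {letters s w} \<in> carrier P" "R `` {[]} \<in> carrier P"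
        unfolding carrier_P by (rule bexI[OF HOL.refl W(1)], rule bexI[OF HOL.refl W(2)])
      ultimately have "R `` {letters s w} = R `` {[]}"
        using bij_betw_imp_inj_on[OF bij] by (rule inj_onD[rotated])
      hence "(letters s w, []) \<in> R" using class_eq[OF W] by (rule iffD1[rotated])
      moreover obtain p0 p where p: "p0 \<in> {[], [C]}" "p = foldr (letter_act G C) (letters s w) p0"
        "p \<noteq> []" "if s then hd p \<noteq> C else hd p = C \<and> 2 \<le> length p"
        using reduced_act[OF A B C w] by (elim bexE exE conjE)
      moreover have "p0 \<in> edge_paths G" using p(1) Cc by (auto simp: edge_paths_def)
      ultimately have "p = p0" using act_R[of "letters s w" "[]" p0] by simp
      with p show False by (auto split: if_splits)
    qed
  qed
qed

section \<open>The Bass-Serre tree\<close>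

definition same_coset :: "('a, 'm) monoid_scheme \<Rightarrow> 'a set \<Rightarrow> 'a \<Rightarrow> 'a \<Rightarrow> bool" where
  "same_coset G T x y \<longleftrightarrow> x \<in> carrier G \<and> y \<in> carrier G \<and> inv\<^bsub>G\<^esub> x \<otimes>\<^bsub>G\<^esub> y \<in> T"

context group
begin

lemma same_coset_refl: "subgroup T G \<Longrightarrow> x \<in> carrier G \<Longrightarrow> same_coset G T x x"
  by (simp add: same_coset_def subgroup.one_closed)

lemma same_coset_sym: "subgroup T G \<Longrightarrow> same_coset G T x y \<Longrightarrow> same_coset G T y x"
  using subgroup.m_inv_closed[of T G "inv x \<otimes> y"] by (auto simp: same_coset_def group_norm)

lemma same_coset_trans:
  "subgroup T G \<Longrightarrow> same_coset G T x y \<Longrightarrow> same_coset G T y z \<Longrightarrow> same_coset G T x z"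
  using subgroup.m_closed[of T G "inv x \<otimes> y" "inv y \<otimes> z"] by (auto simp: same_coset_def group_norm)

lemma same_coset_mult_left:
  "g \<in> carrier G \<Longrightarrow> same_coset G T x y \<Longrightarrow> same_coset G T (g \<otimes> x) (g \<otimes> y)"
  by (auto simp: same_coset_def group_norm)

lemma same_coset_mult_right:
  "subgroup T G \<Longrightarrow> x \<in> carrier G \<Longrightarrow> t \<in> T \<Longrightarrow> same_coset G T x (x \<otimes> t)"
  by (auto simp: same_coset_def subgroup.mem_carrier)

lemma same_coset_mono: "T \<subseteq> T' \<Longrightarrow> same_coset G T x y \<Longrightarrow> same_coset G T' x y"
  by (auto simp: same_coset_def)

lemma same_cosetE:
  assumes "same_coset G T x y"
  obtains "x \<in> carrier G" "y \<in> carrier G" "inv x \<otimes> y \<in> T" "y = x \<otimes> (inv x \<otimes> y)"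
  using assms by (auto simp: same_coset_def)

end

context amalgam
begin

lemma S_carrier: "x \<in> S s \<Longrightarrow> x \<in> carrier G"
  using subgroup.mem_carrier[OF subS] .

lemma C_carrier: "x \<in> C \<Longrightarrow> x \<in> carrier G"
  using subgroup.mem_carrier[OF subC] .

lemma reduced_prod_carrier: "reduced S C s w \<Longrightarrow> word_prod G w \<in> carrier G"
  by (induction w arbitrary: s) (auto simp: S_carrier)

text \<open>Otherwise the inverse of the product could be put in front of the word, as a new letter of the other factor or,
if it lies in \<open>C\<close>, merged into the first letter; this would give a reduced word with product \<open>\<one>\<close>.\<close>

lemma reduced_prod_notin:
  assumes w: "reduced S C s w" "w \<noteq> []"
  shows "word_prod G w \<notin> S (\<not> s)"
proof
  assume a: "word_prod G w \<in> S (\<not> s)"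
  let ?a = "word_prod G w"
  obtain y v where y: "w = y # v" "y \<in> S s" "y \<notin> C" "reduced S C (\<not> s) v"
    using w by (cases w) auto
  have c: "y \<in> carrier G" "word_prod G v \<in> carrier G" "?a \<in> carrier G"
    using y w S_carrier reduced_prod_carrier by blast+
  have one: "inv ?a \<otimes> ?a = \<one>" using c by simp
  show False
  proof (cases "inv ?a \<in> C")
    case True
    have "inv ?a \<otimes> y \<in> S s" using True C_S y(2) by (blast intro: subgroup.m_closed[OF subS])
    moreover have "inv ?a \<otimes> y \<notin> C"
    proof
      assume "inv ?a \<otimes> y \<in> C"
      hence "inv (inv ?a) \<otimes> (inv ?a \<otimes> y) \<in> C"
        using True subC by (meson subgroup.m_closed subgroup.m_inv_closed)
      moreover have "inv (inv ?a) \<otimes> (inv ?a \<otimes> y) = y" using c by simp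
      ultimately show False using y(3) by simp
    qed
    ultimately have "reduced S C s ((inv ?a \<otimes> y) # v)" using y(4) by simp
    from normal_form[OF this] show False using one c y(1) by (simp add: m_assoc)
  next
    case False
    hence "reduced S C (\<not> s) (inv ?a # w)"
      using a w(1) by (simp add: subgroup.m_inv_closed[OF subS])
    from normal_form[OF this] show False using one by simp
  qed
qed

end

text \<open>A graph over the tree: \<open>'e\<close> is its type of edges, \<open>p\<close> maps an edge to a representative of an edge of the tree, and
\<open>RR s\<close> relates two edges that share a vertex over a coset of \<open>S s\<close>. The relations are partial equivalences, so
a subset of \<open>'e\<close> can serve as the set of edges. The last axiom is local injectivity: two edges at the same vertex
with the same image also share their other vertex.\<close>

locale folding = amalgam G S C for G :: "('a, 'm) monoid_scheme" (structure) and S C +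
  fixes RR :: "bool \<Rightarrow> 'e \<Rightarrow> 'e \<Rightarrow> bool" and p :: "'e \<Rightarrow> 'a"
  assumes RR_sym: "RR s e d \<Longrightarrow> RR s d e"
    and RR_trans: "RR s e d \<Longrightarrow> RR s d f \<Longrightarrow> RR s e f"
    and RR_coset: "RR s e d \<Longrightarrow> same_coset G (S s) (p e) (p d)"
    and RR_switch: "RR s e d \<Longrightarrow> same_coset G C (p e) (p d) \<Longrightarrow> RR (\<not> s) e d"
begin

text \<open>A path without backtracking from \<open>e\<close> to \<open>f\<close> with its word of labels. It ends up to local equality, because merging two
steps may leave an edge that is parallel to the intended one.\<close>

fun chain :: "bool \<Rightarrow> 'a list \<Rightarrow> 'e \<Rightarrow> 'e \<Rightarrow> bool" where
  "chain s [] e f \<longleftrightarrow> RR s e f \<and> same_coset G C (p e) (p f)"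
| "chain s (x # w) e f \<longleftrightarrow>
     (\<exists>d. RR s e d \<and> x = inv (p e) \<otimes> p d \<and> \<not> same_coset G C (p e) (p d) \<and> chain (\<not> s) w d f)"

lemma chain_shift:
  assumes "RR s d e" "same_coset G C (p d) (p e)" "chain s w e f"
  shows "\<exists>w'. chain s w' d f"
proof (cases w)
  case Nil
  thus ?thesis using assms RR_trans same_coset_trans[OF subC] by (intro exI[of _ "[]"]) auto
next
  case (Cons x v)
  then obtain e' where e': "RR s e e'" "\<not> same_coset G C (p e) (p e')" "chain (\<not> s) v e' f"
    using assms by auto
  have "\<not> same_coset G C (p d) (p e')"
    using e'(2) assms(2) same_coset_trans[OF subC] same_coset_sym[OF subC] by blast
  moreover have "RR s d e'" using RR_trans[OF assms(1) e'(1)] .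
  ultimately have "chain s ((inv (p d) \<otimes> p e') # v) d f" using e'(3) by auto
  thus ?thesis by blast
qed

lemma chain_extend:
  assumes "RR t d e" "chain s w e f"
  shows "\<exists>s' w'. chain s' w' d f"
proof (cases "same_coset G C (p d) (p e)")
  case True
  hence "RR s d e" using assms RR_switch by (cases "s = t") auto
  thus ?thesis using chain_shift assms True by blast
next
  case nC: False
  show ?thesis
  proof (cases "t = s")
    case False
    hence "chain t ((inv (p d) \<otimes> p e) # w) d f" using assms nC by auto
    thus ?thesis by blast
  next
    case True
    show ?thesis
    proof (cases w)
      case Nil
      hence "RR s e f" "same_coset G C (p e) (p f)" using assms by auto
      hence "RR (\<not> s) e f" using RR_switch by blast
      hence "chain (\<not> s) [] e f" using \<open>same_coset G C (p e) (p f)\<close> by simp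
      hence "chain t ((inv (p d) \<otimes> p e) # []) d f" using assms nC True by auto
      thus ?thesis by blast
    next
      case (Cons x v)
      then obtain e' where e': "RR s e e'" "chain (\<not> s) v e' f" using assms by auto
      have d: "RR s d e'" using e' assms True RR_trans by blast
      show ?thesis
      proof (cases "same_coset G C (p d) (p e')")
        case True
        thus ?thesis using chain_shift[OF RR_switch[OF d True] True e'(2)] by blast
      next
        case False
        hence "chain s ((inv (p d) \<otimes> p e') # v) d f" using d e' by auto
        thus ?thesis by blast
      qed
    qed
  qed
qed

lemma chain_reduced: "chain s w e f \<Longrightarrow> reduced S C s w"
  by (induction w arbitrary: s e) (use RR_coset in \<open>auto simp: same_coset_def\<close>)

lemma chain_prod:
  "chain s w e f \<Longrightarrow> p e \<in> carrier G \<and> p f \<in> carrier G \<and> (\<exists>c\<in>C. inv (p e) \<otimes> p f = word_prod G w \<otimes> c)"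
proof (induction w arbitrary: s e)
  case Nil
  thus ?case by (auto simp: same_coset_def C_carrier)
next
  case (Cons x w)
  then obtain d where d: "RR s e d" "x = inv (p e) \<otimes> p d" "chain (\<not> s) w d f" by auto
  obtain c where c: "c \<in> C" "inv (p d) \<otimes> p f = word_prod G w \<otimes> c" "p d \<in> carrier G" "p f \<in> carrier G"
    using Cons.IH[OF d(3)] by blast
  have e: "p e \<in> carrier G" using RR_coset[OF d(1)] by (simp add: same_coset_def)
  have "word_prod G w \<in> carrier G" using chain_reduced[OF d(3)] reduced_prod_carrier by blast
  hence "inv (p e) \<otimes> p f = word_prod G (x # w) \<otimes> c"
    using c e C_carrier[OF c(1)] by (simp add: d(2) m_assoc c(2)[symmetric])
  thus ?case using c e by blast
qed

text \<open>A path from \<open>e\<close> to \<open>f\<close> can be reduced, and local injectivity keeps the image of the reduced path reduced. The image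
is closed up to a step in \<open>S s\<close>, so by the normal form theorem no step of the other type can remain.\<close>

theorem locally_injective_imp_injective:
  assumes "(\<lambda>d e. \<exists>t. RR t d e)\<^sup>*\<^sup>* e f" "RR s f f" "same_coset G (S s) (p e) (p f)"
  shows "RR s e f"
proof -
  have "\<exists>t w. chain t w e f"
    using assms(1)
  proof (induction rule: converse_rtranclp_induct)
    case base
    have "chain s [] f f"
      using assms(2) RR_coset[OF assms(2)] same_coset_refl[OF subC] by (auto simp: same_coset_def)
    thus ?case by blast
  next
    case (step d e)
    thus ?case using chain_extend by blast
  qed
  then obtain t w where w: "chain t w e f" by blast
  \<comment> \<open>A reduced path that starts with a step of the other type cannot return to the same coset.\<close>
  have closes: "u = []" if u: "chain (\<not> s) u d f" "same_coset G (S s) (p d) (p f)" for u d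
  proof (rule ccontr)
    assume "u \<noteq> []"
    obtain c where c: "c \<in> C" "inv (p d) \<otimes> p f = word_prod G u \<otimes> c"
      using chain_prod[OF u(1)] by blast
    have red: "reduced S C (\<not> s) u" using chain_reduced[OF u(1)] .
    have cc: "c \<in> carrier G" "word_prod G u \<in> carrier G"
      using C_carrier[OF c(1)] reduced_prod_carrier[OF red] by auto
    have "word_prod G u \<otimes> c \<otimes> inv c \<in> S s"
      using u(2) c C_S subS unfolding same_coset_def
      by (metis subgroup.m_closed subgroup.m_inv_closed subsetD)
    hence "word_prod G u \<in> S s" using cc by (simp add: m_assoc)
    thus False using reduced_prod_notin[OF red \<open>u \<noteq> []\<close>] by simp
  qed
  show ?thesis
  proof (cases "t = s")
    case False
    with w have "chain (\<not> s) w e f" by (cases s; cases t) auto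
    with closes assms(3) have "chain (\<not> s) [] e f" by blast
    thus ?thesis using RR_switch by fastforce
  next
    case True
    show ?thesis
    proof (cases w)
      case Nil
      thus ?thesis using w True by simp
    next
      case (Cons x v)
      then obtain d where d: "RR s e d" "chain (\<not> s) v d f" using w True by auto
      have "same_coset G (S s) (p d) (p f)"
        using RR_coset[OF d(1)] assms(3) same_coset_trans[OF subS] same_coset_sym[OF subS] by blast
      hence "chain (\<not> s) [] d f" using closes d(2) by blast
      hence "RR s d f" using RR_switch by fastforce
      thus ?thesis using d(1) RR_trans by blast
    qed
  qed
qed

end

context amalgam
begin

definition adjacent :: "'a set \<Rightarrow> 'a \<Rightarrow> 'a \<Rightarrow> bool" where
  "adjacent U x y \<longleftrightarrow> x \<in> U \<and> y \<in> U \<and> (\<exists>s. same_coset G (S s) x y)"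

definition connected_in :: "'a set \<Rightarrow> bool" where
  "connected_in U \<longleftrightarrow> (\<forall>x\<in>U. \<forall>y\<in>U. (adjacent U)\<^sup>*\<^sup>* x y)"

lemma adjacent_sym: "adjacent U x y \<Longrightarrow> adjacent U y x"
  using same_coset_sym[OF subS] by (auto simp: adjacent_def)

lemma path_sym: "(adjacent U)\<^sup>*\<^sup>* x y \<Longrightarrow> (adjacent U)\<^sup>*\<^sup>* y x"
  by (rule sympD[OF symp_rtranclp]) (auto intro: sympI adjacent_sym)

lemma path_translate:
  assumes "(adjacent U)\<^sup>*\<^sup>* x y" "g \<in> carrier G" "\<And>u. u \<in> U \<Longrightarrow> g \<otimes> u \<in> V"
  shows "(adjacent V)\<^sup>*\<^sup>* (g \<otimes> x) (g \<otimes> y)"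
  using assms(1)
proof (induction rule: rtranclp_induct)
  case (step y z)
  hence "adjacent V (g \<otimes> y) (g \<otimes> z)"
    using assms same_coset_mult_left unfolding adjacent_def by meson
  with step show ?case by (simp add: rtranclp.rtrancl_into_rtrancl)
qed simp

lemma path_mono: "(adjacent U)\<^sup>*\<^sup>* x y \<Longrightarrow> U \<subseteq> V \<Longrightarrow> (adjacent V)\<^sup>*\<^sup>* x y"
  by (erule rtranclp_mono[THEN predicate2D, rotated]) (auto simp: adjacent_def)

text \<open>Writing \<open>g\<close> as a product of elements of the two factors, the partial products form a path from \<open>\<one>\<close> to \<open>g\<close>.\<close>

lemma ex_finite_path:
  assumes "g \<in> carrier G"
  shows "\<exists>Q. finite Q \<and> Q \<subseteq> carrier G \<and> \<one> \<in> Q \<and> g \<in> Q \<and> (\<forall>q\<in>Q. (adjacent Q)\<^sup>*\<^sup>* \<one> q)"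
proof -
  have single: "\<exists>Q. finite Q \<and> Q \<subseteq> carrier G \<and> \<one> \<in> Q \<and> x \<in> Q \<and> (\<forall>q\<in>Q. (adjacent Q)\<^sup>*\<^sup>* \<one> q)"
    if "x \<in> S s" for x s
    using that S_carrier[OF that]
    by (intro exI[of _ "{\<one>, x}"]) (auto simp: adjacent_def same_coset_def intro!: r_into_rtranclp)
  have "g \<in> generate G (S True \<union> S False)" using assms gen by simp
  thus ?thesis
  proof (induction rule: generate.induct)
    case one
    show ?case by (intro exI[of _ "{\<one>}"]) auto
  next
    case (incl h)
    thus ?case using single by blast
  next
    case (inv h)
    thus ?case using single subgroup.m_inv_closed[OF subS] by blast
  next
    case (eng g h)
    then obtain Q R where Q: "finite Q" "Q \<subseteq> carrier G" "\<one> \<in> Q" "g \<in> Q" "\<forall>q\<in>Q. (adjacent Q)\<^sup>*\<^sup>* \<one> q"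
      and R: "finite R" "R \<subseteq> carrier G" "\<one> \<in> R" "h \<in> R" "\<forall>q\<in>R. (adjacent R)\<^sup>*\<^sup>* \<one> q"
      by blast
    let ?Q = "Q \<union> (\<lambda>r. g \<otimes> r) ` R"
    have g: "g \<in> carrier G" using Q by auto
    have 1: "(adjacent ?Q)\<^sup>*\<^sup>* \<one> q" if "q \<in> Q" for q using Q(5) that by (blast intro: path_mono)
    have "(adjacent ?Q)\<^sup>*\<^sup>* (g \<otimes> \<one>) (g \<otimes> r)" if "r \<in> R" for r
      using R(5) that g by (intro path_translate[of R]) auto
    hence "(adjacent ?Q)\<^sup>*\<^sup>* \<one> (g \<otimes> r)" if "r \<in> R" for r
      using 1[OF Q(4)] that g by (metis r_one rtranclp_trans)
    hence "\<forall>q\<in>?Q. (adjacent ?Q)\<^sup>*\<^sup>* \<one> q" using 1 by blast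
    moreover have "finite ?Q" "?Q \<subseteq> carrier G" "\<one> \<in> ?Q" "g \<otimes> h \<in> ?Q" using Q R g by auto
    ultimately show ?case by blast
  qed
qed

lemma mem_hull: "x \<in> H <#> Q <#> C \<longleftrightarrow> (\<exists>h\<in>H. \<exists>q\<in>Q. \<exists>c\<in>C. x = h \<otimes> q \<otimes> c)"
  by (auto simp: set_mult_def)

lemma hull_left:
  assumes "subgroup H G" "Q \<subseteq> carrier G" "h \<in> H" "u \<in> H <#> Q <#> C"
  shows "h \<otimes> u \<in> H <#> Q <#> C"
proof -
  interpret H: subgroup H G by fact
  obtain h' q c where *: "h' \<in> H" "q \<in> Q" "c \<in> C" "u = h' \<otimes> q \<otimes> c"
    using assms(4) unfolding mem_hull by blast
  hence "h \<otimes> u = (h \<otimes> h') \<otimes> q \<otimes> c" using assms(2,3) C_carrier by (auto simp: m_assoc)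
  thus ?thesis unfolding mem_hull using * assms(3) by blast
qed

lemma hull_right:
  assumes "subgroup H G" "Q \<subseteq> carrier G" "c \<in> C" "u \<in> H <#> Q <#> C"
  shows "u \<otimes> c \<in> H <#> Q <#> C"
proof -
  interpret H: subgroup H G by fact
  obtain h q c' where *: "h \<in> H" "q \<in> Q" "c' \<in> C" "u = h \<otimes> q \<otimes> c'"
    using assms(4) unfolding mem_hull by blast
  hence "u \<otimes> c = h \<otimes> q \<otimes> (c' \<otimes> c)" using assms(2,3) C_carrier by (auto simp: m_assoc)
  thus ?thesis unfolding mem_hull using * assms(3) subgroup.m_closed[OF subC] by blast
qed

lemma hull_carrier: "subgroup H G \<Longrightarrow> Q \<subseteq> carrier G \<Longrightarrow> H <#> Q <#> C \<subseteq> carrier G"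
  using subgroup.subset[of H G] subgroup.subset[OF subC] by (intro set_mult_closed) simp_all

lemma subset_hull:
  assumes "subgroup H G" "Q \<subseteq> carrier G"
  shows "Q \<subseteq> H <#> Q <#> C"
proof
  fix q assume "q \<in> Q"
  moreover from this have "q = \<one> \<otimes> q \<otimes> \<one>" using assms by auto
  ultimately show "q \<in> H <#> Q <#> C"
    unfolding mem_hull using subgroup.one_closed[OF subC] subgroup.one_closed[OF assms(1)] by blast
qed

text \<open>Take for \<open>Q\<close> the paths from \<open>\<one>\<close> to the elements of a finite generating set of \<open>H\<close>; their translates by \<open>H\<close> join
\<open>\<one>\<close> to every element of \<open>H\<close>.\<close>

lemma ex_connected_hull:
  assumes "fg_subgroup H G"
  shows "\<exists>Q. finite Q \<and> Q \<subseteq> carrier G \<and> \<one> \<in> Q \<and> connected_in (H <#> Q <#> C)"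
proof -
  obtain T where T: "finite T" "T \<subseteq> carrier G" "H = generate G T"
    using assms by (auto simp: fg_subgroup_def)
  interpret H: subgroup H G using fg_subgroup_imp_subgroup[OF assms] .
  have "\<forall>t\<in>T. \<exists>Q. finite Q \<and> Q \<subseteq> carrier G \<and> \<one> \<in> Q \<and> t \<in> Q \<and> (\<forall>q\<in>Q. (adjacent Q)\<^sup>*\<^sup>* \<one> q)"
    using ex_finite_path T(2) by blast
  then obtain QQ where QQ: "\<And>t. t \<in> T \<Longrightarrow> finite (QQ t) \<and> QQ t \<subseteq> carrier G \<and> \<one> \<in> QQ t \<and> t \<in> QQ t \<and>
      (\<forall>q\<in>QQ t. (adjacent (QQ t))\<^sup>*\<^sup>* \<one> q)"
    by metis
  define Q where "Q = insert \<one> (\<Union>t\<in>T. QQ t)"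
  let ?U = "H <#> Q <#> C"
  have Qc: "Q \<subseteq> carrier G" "finite Q" "\<one> \<in> Q" using T QQ by (auto simp: Q_def)
  note H_inv = hull_left[OF H.subgroup_axioms Qc(1)]
  note Q_U = subset_hull[OF H.subgroup_axioms Qc(1)]
  have pathQ: "(adjacent ?U)\<^sup>*\<^sup>* \<one> q" if q: "q \<in> Q" for q
  proof (cases "q = \<one>")
    case False
    then obtain t where "t \<in> T" "q \<in> QQ t" using q by (auto simp: Q_def)
    moreover from this have "QQ t \<subseteq> ?U" using Q_U by (auto simp: Q_def)
    ultimately show ?thesis using QQ path_mono by blast
  qed simp
  have pathH: "(adjacent ?U)\<^sup>*\<^sup>* \<one> h" if "h \<in> H" for h
  proof -
    have "h \<in> generate G T" using that T(3) by simp
    thus ?thesis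
    proof (induction rule: generate.induct)
      case (incl t)
      hence "t \<in> Q" using QQ by (auto simp: Q_def)
      thus ?case by (rule pathQ)
    next
      case (inv t)
      hence "t \<in> QQ t" using QQ by blast
      with inv have t: "t \<in> Q" "t \<in> carrier G" "inv t \<in> H"
        using T(2) T(3) by (auto simp: Q_def intro: generate.inv)
      have "(adjacent ?U)\<^sup>*\<^sup>* (inv t \<otimes> \<one>) (inv t \<otimes> t)"
        using t H_inv by (intro path_translate[OF pathQ]) auto
      thus ?case using t path_sym by simp
    next
      case (eng g h)
      have g: "g \<in> H" "h \<in> H" using eng T(3) by auto
      have "(adjacent ?U)\<^sup>*\<^sup>* (g \<otimes> \<one>) (g \<otimes> h)"
        using g H_inv eng by (intro path_translate[of ?U]) auto
      thus ?case using eng g by (metis H.mem_carrier r_one rtranclp_trans)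
    qed simp
  qed
  have "(adjacent ?U)\<^sup>*\<^sup>* \<one> u" if u: "u \<in> ?U" for u
  proof -
    obtain h q c where *: "h \<in> H" "q \<in> Q" "c \<in> C" "u = h \<otimes> q \<otimes> c"
      using u unfolding mem_hull by blast
    have hq: "h \<otimes> q \<in> carrier G" "h \<otimes> q \<in> ?U" using * Qc H_inv Q_U by auto
    have "(adjacent ?U)\<^sup>*\<^sup>* (h \<otimes> \<one>) (h \<otimes> q)"
      using * H_inv by (intro path_translate[OF pathQ]) auto
    moreover have "adjacent ?U (h \<otimes> q) u"
      unfolding adjacent_def using same_coset_mult_right[OF subS hq(1), of c] C_S * hq u by blast
    ultimately show ?thesis using pathH[OF *(1)] * by (metis H.mem_carrier r_one rtranclp.rtrancl_into_rtrancl rtranclp_trans)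
  qed
  hence "connected_in ?U" unfolding connected_in_def by (meson path_sym rtranclp_trans)
  thus ?thesis using Qc by blast
qed

text \<open>Let \<open>Z\<close> be the component of \<open>\<one>\<close> in \<open>U \<inter> V\<close>. Gluing disjoint copies of \<open>U\<close> and \<open>V\<close> along the vertices of \<open>Z\<close> gives a
connected graph over the tree. It is locally injective: an edge that lies in both sets and has a vertex in common with
\<open>Z\<close> belongs to \<open>Z\<close>. So the graph embeds, and the two copies of an element of \<open>U \<inter> V\<close> can only agree if it lies in
\<open>Z\<close>.\<close>

lemma connected_in_inter:
  assumes U: "connected_in U" "\<one> \<in> U" "U \<subseteq> carrier G" "\<And>u c. u \<in> U \<Longrightarrow> c \<in> C \<Longrightarrow> u \<otimes> c \<in> U"
    and V: "connected_in V" "\<one> \<in> V" "V \<subseteq> carrier G" "\<And>u c. u \<in> V \<Longrightarrow> c \<in> C \<Longrightarrow> u \<otimes> c \<in> V"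
  shows "connected_in (U \<inter> V)"
proof -
  define Z where "Z = {z. (adjacent (U \<inter> V))\<^sup>*\<^sup>* \<one> z}"
  define W where "W i = (if i then U else V)" for i :: bool
  define RR where "RR s d e \<longleftrightarrow> snd d \<in> W (fst d) \<and> snd e \<in> W (fst e) \<and> same_coset G (S s) (snd d) (snd e) \<and>
    (fst d = fst e \<or> (\<exists>z\<in>Z. same_coset G (S s) (snd d) z))" for s and d e :: "bool \<times> 'a"
  note sc = same_coset_sym[OF subS] same_coset_trans[OF subS]
  have one: "\<one> \<in> Z" by (simp add: Z_def)
  have Z_step: "x \<in> Z" if "z \<in> Z" "same_coset G (S s) x z" "x \<in> U \<inter> V" for x z s
  proof -
    have "z \<in> U \<inter> V"
      using that(1) U(2) V(2) unfolding Z_def by (auto elim: rtranclp.cases simp: adjacent_def)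
    hence "adjacent (U \<inter> V) z x" unfolding adjacent_def using that sc by blast
    thus ?thesis using that(1) unfolding Z_def by (auto intro: rtranclp.rtrancl_into_rtrancl)
  qed
  have W_C: "x \<in> W i" if "y \<in> W i" "same_coset G C x y" for x y i
  proof -
    have "same_coset G C y x" using that same_coset_sym[OF subC] by blast
    then obtain c where "c \<in> C" "x = y \<otimes> c" by (metis same_cosetE)
    thus ?thesis using that U(4) V(4) by (auto simp: W_def split: if_splits)
  qed
  interpret folding G S C RR snd
  proof
    show "RR s e d" if "RR s d e" for s d e using that sc unfolding RR_def by metis
    show "RR s d f" if "RR s d e" "RR s e f" for s d e f using that sc unfolding RR_def by metis
    show "same_coset G (S s) (snd d) (snd e)" if "RR s d e" for s d e using that by (simp add: RR_def)
    show "RR (\<not> s) d e" if r: "RR s d e" and c: "same_coset G C (snd d) (snd e)" for s d e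
    proof -
      have "\<exists>z\<in>Z. same_coset G (S (\<not> s)) (snd d) z" if ne: "fst d \<noteq> fst e"
      proof -
        have "snd d \<in> W (fst d)" "snd d \<in> W (fst e)"
          using r c W_C unfolding RR_def by blast+
        hence "snd d \<in> U \<inter> V" using ne by (auto simp: W_def split: if_splits)
        moreover obtain z where "z \<in> Z" "same_coset G (S s) (snd d) z" using r ne by (auto simp: RR_def)
        ultimately have "snd d \<in> Z" using Z_step by blast
        moreover have "same_coset G (S (\<not> s)) (snd d) (snd d)"
          using c by (intro same_coset_refl[OF subS]) (simp add: same_coset_def)
        ultimately show ?thesis by blast
      qed
      thus ?thesis using r same_coset_mono[OF C_S c] unfolding RR_def by blast
    qed
  qed
  have lift: "(\<lambda>d e. \<exists>t. RR t d e)\<^sup>*\<^sup>* (i, x) (i, y)" if "(adjacent (W i))\<^sup>*\<^sup>* x y" for i x y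
    using that
  proof (induction rule: rtranclp_induct)
    case (step y z)
    hence "\<exists>t. RR t (i, y) (i, z)" by (auto simp: adjacent_def RR_def)
    thus ?case using step.IH by (rule rtranclp.rtrancl_into_rtrancl[rotated])
  qed simp
  have con: "(adjacent (W i))\<^sup>*\<^sup>* x y" if "x \<in> W i" "y \<in> W i" for i x y
    using that U(1) V(1) by (auto simp: W_def connected_in_def)
  have "x \<in> Z" if x: "x \<in> U \<inter> V" for x
  proof -
    have W: "x \<in> W i" "\<one> \<in> W i" for i using x U V by (auto simp: W_def)
    have xc: "x \<in> carrier G" using x U by auto
    have "RR True (True, \<one>) (False, \<one>)"
      using W(2) one same_coset_refl[OF subS one_closed] by (auto simp: RR_def)
    hence "(\<lambda>d e. \<exists>t. RR t d e)\<^sup>*\<^sup>* (True, \<one>) (False, \<one>)" by blast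
    hence "(\<lambda>d e. \<exists>t. RR t d e)\<^sup>*\<^sup>* (True, x) (False, x)"
      using lift[OF con[OF W(1,2)], of True] lift[OF con[OF W(2,1)], of False]
      by (meson rtranclp_trans)
    moreover have "RR True (False, x) (False, x)"
      using W xc same_coset_refl[OF subS] by (auto simp: RR_def)
    ultimately have "RR True (True, x) (False, x)"
      using locally_injective_imp_injective xc same_coset_refl[OF subS] by auto
    then obtain z where "z \<in> Z" "same_coset G (S True) x z" by (auto simp: RR_def)
    thus ?thesis using Z_step x by blast
  qed
  thus ?thesis unfolding connected_in_def Z_def by (blast intro: path_sym rtranclp_trans)
qed

end

section \<open>Finiteness of vertex stabilisers, and groups acting with finitely many orbits\<close>

text \<open>The stabiliser in \<open>H\<close> of the coset \<open>x T\<close>.\<close>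

definition stab :: "('a, 'm) monoid_scheme \<Rightarrow> 'a set \<Rightarrow> 'a set \<Rightarrow> 'a \<Rightarrow> 'a set" where
  "stab G H T x = {h \<in> H. inv\<^bsub>G\<^esub> x \<otimes>\<^bsub>G\<^esub> h \<otimes>\<^bsub>G\<^esub> x \<in> T}"

context group
begin

lemma stab_eq_conj:
  assumes "H \<subseteq> carrier G" "x \<in> carrier G"
  shows "stab G H T x = conj_subgroup G (conj_subgroup G H x \<inter> T) (inv x)"
proof (rule Set.set_eqI)
  fix z
  have T: "conj_subgroup G H x \<inter> T \<subseteq> carrier G" using conj_subgroup_subset[OF assms] by blast
  show "z \<in> stab G H T x \<longleftrightarrow> z \<in> conj_subgroup G (conj_subgroup G H x \<inter> T) (inv x)"
  proof (cases "z \<in> carrier G")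
    case True
    hence "x \<otimes> (inv x \<otimes> z \<otimes> x) \<otimes> inv x = z" using assms by (simp add: m_assoc)
    thus ?thesis using True assms T by (simp add: stab_def mem_conj_subgroup)
  next
    case False
    thus ?thesis using assms T by (auto simp: stab_def mem_conj_subgroup)
  qed
qed

lemma fg_stab:
  assumes "H \<subseteq> carrier G" "x \<in> carrier G" "fg_subgroup (conj_subgroup G H x \<inter> T) G"
  shows "fg_subgroup (stab G H T x) G"
  unfolding stab_eq_conj[OF assms(1,2)] using assms by (intro fg_conj_subgroup) auto

lemma conj_subgroup_one:
  assumes "H \<subseteq> carrier G"
  shows "conj_subgroup G H \<one> = H"
proof -
  have "(\<lambda>h. inv \<one> \<otimes> h \<otimes> \<one>) ` H = id ` H" using assms by (intro image_cong) auto
  thus ?thesis by (simp add: conj_subgroup_image)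
qed

end

context amalgam
begin

text \<open>At the vertex \<open>q S s\<close>, the edges of a subgraph with finitely many \<open>H\<close>-orbits of edges fall into finitely many orbits
under the stabiliser of the vertex, because two edges at this vertex in the same \<open>H\<close>-orbit differ by an element of that
stabiliser. After translation by \<open>inv q\<close> the stabiliser becomes \<open>S s \<inter> conj_subgroup G H q\<close>.\<close>

lemma ex_edge_representatives:
  assumes H: "subgroup H G" and Q: "finite Q" "Q \<subseteq> carrier G" and q: "q \<in> carrier G"
  shows "\<exists>F. finite F \<and> F \<subseteq> S s \<and>
           inj_on (\<lambda>f. double_coset G (S s \<inter> conj_subgroup G H q) f C) F \<and>
           (\<forall>a\<in>S s. q \<otimes> a \<in> H <#> Q <#> C \<longrightarrow>
              (\<exists>f\<in>F. a \<in> double_coset G (S s \<inter> conj_subgroup G H q) f C))"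
proof -
  let ?M = "S s \<inter> conj_subgroup G H q"
  define dc where "dc a = double_coset G ?M a C" for a
  define Y where "Y r = {a \<in> S s. \<exists>h\<in>H. \<exists>c\<in>C. q \<otimes> a = h \<otimes> r \<otimes> c}" for r
  interpret H: subgroup H G by (rule H)
  have M: "subgroup ?M G" using subgroup_conj_subgroup[OF H q] subS subgroups_Inter_pair by blast
  have sub: "dc a = dc b" if ab: "a \<in> Y r" "b \<in> Y r" and "r \<in> Q" for a b r
  proof -
    obtain h c k d where *: "a \<in> S s" "b \<in> S s" "h \<in> H" "c \<in> C" "k \<in> H" "d \<in> C"
      "q \<otimes> a = h \<otimes> r \<otimes> c" "q \<otimes> b = k \<otimes> r \<otimes> d"
      using ab unfolding Y_def by blast
    have ca: "a \<in> carrier G" "b \<in> carrier G" "c \<in> carrier G" "d \<in> carrier G" "r \<in> carrier G"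
      using * S_carrier C_carrier that Q by auto
    define m where "m = inv q \<otimes> (h \<otimes> inv k) \<otimes> q"
    have mc: "m \<in> carrier G" using * q by (simp add: m_def)
    have "inv k \<otimes> (q \<otimes> b) = r \<otimes> d" using * ca q by (simp add: m_assoc)
    hence r: "r = inv k \<otimes> (q \<otimes> b) \<otimes> inv d" using * ca q by (simp add: m_assoc)
    have "a = inv q \<otimes> (h \<otimes> r \<otimes> c)" using * ca q by (metis inv_cancel_left(1))
    also have "\<dots> = m \<otimes> (b \<otimes> (inv d \<otimes> c))"
      unfolding m_def by (subst r) (use *(3,5) ca q in \<open>simp add: m_assoc\<close>)
    finally have a: "a = m \<otimes> (b \<otimes> (inv d \<otimes> c))" .
    have dcC: "inv d \<otimes> c \<in> C" using * subC by (meson subgroup.m_closed subgroup.m_inv_closed)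
    have "m = a \<otimes> inv (b \<otimes> (inv d \<otimes> c))" using a mc ca by (simp add: group_norm)
    moreover have "b \<otimes> (inv d \<otimes> c) \<in> S s" using * dcC C_S subgroup.m_closed[OF subS] by blast
    ultimately have "m \<in> S s" using * subgroup.m_closed[OF subS] subgroup.m_inv_closed[OF subS] by metis
    moreover have "q \<otimes> m \<otimes> inv q = h \<otimes> inv k" using * q by (simp add: m_def m_assoc)
    hence "m \<in> conj_subgroup G H q" using * q mc H.subset by (simp add: mem_conj_subgroup)
    ultimately have "a \<in> dc b" unfolding dc_def mem_double_coset using a dcC by blast
    thus ?thesis unfolding dc_def using double_coset_eqI[OF M subC ca(2)] by blast
  qed
  have "finite (dc ` Y r)" if "r \<in> Q" for r
  proof (cases "Y r = {}")
    case False
    then obtain a where a: "a \<in> Y r" by blast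
    have "dc ` Y r \<subseteq> {dc a}" using sub[OF _ a that] by blast
    thus ?thesis using finite_subset by blast
  qed simp
  hence fin: "finite (dc ` (\<Union>r\<in>Q. Y r))" using Q by (simp add: image_UN)
  obtain F where F: "F \<subseteq> (\<Union>r\<in>Q. Y r)" "inj_on dc F" "dc ` (\<Union>r\<in>Q. Y r) = dc ` F"
    using subset_image_inj[of "dc ` (\<Union>r\<in>Q. Y r)" dc "\<Union>r\<in>Q. Y r"] by auto
  have "finite F" using F fin by (metis finite_imageD)
  moreover have "F \<subseteq> S s" using F(1) by (auto simp: Y_def)
  moreover have "\<exists>f\<in>F. a \<in> dc f" if a: "a \<in> S s" "q \<otimes> a \<in> H <#> Q <#> C" for a
  proof -
    have "a \<in> (\<Union>r\<in>Q. Y r)" using a unfolding mem_hull by (auto simp: Y_def)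
    then obtain f where "f \<in> F" "dc a = dc f" using F(3) by blast
    moreover have "a \<in> dc a" unfolding dc_def using double_coset_self[OF M subC] a S_carrier by blast
    ultimately show ?thesis by blast
  qed
  ultimately show ?thesis using F(2) unfolding dc_def by blast
qed

text \<open>Let \<open>M = H \<inter> S s\<close> be the stabiliser in \<open>H\<close> of the vertex \<open>S s\<close>, in the hull of \<open>H\<close>. Replace \<open>M\<close> by a finitely generated
subgroup \<open>P\<close>: that is, split each vertex \<open>h S s\<close> with \<open>h \<in> H\<close> into one vertex for each coset of \<open>P\<close> in \<open>h M\<close>. As soon as
\<open>P\<close> contains the stabilisers of representatives of the edges at \<open>S s\<close>, each edge keeps a well-defined end, and the
split graph maps locally injectively to the tree. If \<open>P\<close> also contains the finitely many elements of \<open>M\<close> by which the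
paths to the generators of \<open>H\<close> turn at these vertices, then the graph is connected. So it embeds in the tree,
no vertex has been split, and \<open>P = M\<close>.\<close>

theorem fg_inter_factor:
  assumes rel: "fgip_rel G C" and fgH: "fg_subgroup H G"
  shows "fg_subgroup (H \<inter> S s) G"
proof -
  have H: "subgroup H G" using fg_subgroup_imp_subgroup[OF fgH] .
  interpret H: subgroup H G by (rule H)
  define M where "M = S s \<inter> H"
  have M: "subgroup M G" unfolding M_def using H subS subgroups_Inter_pair by blast
  interpret M: subgroup M G by (rule M)
  obtain Q where Q: "finite Q" "Q \<subseteq> carrier G" "\<one> \<in> Q" "connected_in (H <#> Q <#> C)"
    using ex_connected_hull[OF fgH] by blast
  define U where "U = H <#> Q <#> C"
  have oneU: "\<one> \<in> U" using subset_hull[OF H Q(2)] Q(3) by (auto simp: U_def)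
  have Uc: "U \<subseteq> carrier G" unfolding U_def by (rule hull_carrier[OF H Q(2)])
  note UH = hull_left[OF H Q(2), folded U_def]
  obtain F where F: "finite F" "F \<subseteq> S s" "inj_on (\<lambda>f. double_coset G M f C) F"
    "\<And>a. a \<in> S s \<Longrightarrow> a \<in> U \<Longrightarrow> \<exists>f\<in>F. a \<in> double_coset G M f C"
  proof -
    have "M = S s \<inter> conj_subgroup G H \<one>" using conj_subgroup_one H.subset by (simp add: M_def)
    thus thesis using ex_edge_representatives[OF H Q(1,2) one_closed, of s] that
      unfolding U_def by (metis S_carrier l_one)
  qed
  have reps: "\<exists>m\<in>M. \<exists>f\<in>F. \<exists>c\<in>C. a = m \<otimes> f \<otimes> c" if a: "a \<in> S s" "a \<in> U" for a
  proof -
    obtain f m c where "f \<in> F" "m \<in> M" "c \<in> C" "a = m \<otimes> (f \<otimes> c)"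
      using F(4)[OF a] by (auto simp: mem_double_coset)
    moreover from this have "a = m \<otimes> f \<otimes> c"
      using F(2) S_carrier C_carrier by (auto simp: m_assoc subsetD)
    ultimately show ?thesis by blast
  qed
  \<comment> \<open>The edge stabilisers are finitely generated by the relative f.g.i.p.\<close>
  have "\<exists>N. finite N \<and> N \<subseteq> M \<and> stab G H C f \<subseteq> generate G N" if f: "f \<in> F" for f
  proof -
    have fc: "f \<in> S s" "f \<in> carrier G" using f F S_carrier by auto
    have "fg_subgroup (conj_subgroup G H f \<inter> C) G"
      using rel fg_conj_subgroup[OF fgH fc(2)] by (simp add: fgip_rel_def)
    from fg_stab[OF H.subset fc(2) this] obtain N
      where N: "finite N" "N \<subseteq> carrier G" "stab G H C f = generate G N" by (auto simp: fg_subgroup_def)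
    have "N \<subseteq> M"
    proof
      fix n assume "n \<in> N"
      hence n: "n \<in> H" "inv f \<otimes> n \<otimes> f \<in> C" using N(3) generate.incl[of n N G] by (auto simp: stab_def)
      hence "f \<otimes> (inv f \<otimes> n \<otimes> f) \<otimes> inv f \<in> S s"
        using fc C_S subS by (meson subgroup.m_closed subgroup.m_inv_closed subsetD)
      thus "n \<in> M" using n fc by (simp add: M_def m_assoc)
    qed
    thus ?thesis using N by blast
  qed
  then obtain NF where NF: "\<And>f. f \<in> F \<Longrightarrow> finite (NF f) \<and> NF f \<subseteq> M \<and> stab G H C f \<subseteq> generate G (NF f)"
    by metis
  define N1 where "N1 = (\<Union>f\<in>F. NF f)"
  have N1: "finite N1" "N1 \<subseteq> M" using F(1) NF by (auto simp: N1_def)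
  \<comment> \<open>The edges at the vertex of the split graph that belongs to the coset of \<open>P\<close> containing \<open>h\<close>.\<close>
  define star where "star P h x \<longleftrightarrow> (\<exists>n\<in>P. \<exists>f\<in>F. \<exists>c\<in>C. x = h \<otimes> n \<otimes> f \<otimes> c)" for P h x
  define good where "good P \<longleftrightarrow> subgroup P G \<and> N1 \<subseteq> P \<and> P \<subseteq> M" for P
  have star_iff: "star P h (k \<otimes> f \<otimes> c) \<longleftrightarrow> inv h \<otimes> k \<in> P"
    if "good P" "h \<in> H" "k \<in> H" "f \<in> F" "c \<in> C" for P h k f c
  proof -
    have P: "subgroup P G" "N1 \<subseteq> P" "P \<subseteq> M" using that by (auto simp: good_def)
    have car: "f \<in> S s" "f \<in> carrier G" "c \<in> carrier G" "h \<in> carrier G" "k \<in> carrier G"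
      using that F S_carrier C_carrier by auto
    show ?thesis
    proof
      assume "inv h \<otimes> k \<in> P"
      moreover have "k \<otimes> f \<otimes> c = h \<otimes> (inv h \<otimes> k) \<otimes> f \<otimes> c" using car by simp
      ultimately show "star P h (k \<otimes> f \<otimes> c)" unfolding star_def using that by blast
    next
      assume "star P h (k \<otimes> f \<otimes> c)"
      then obtain n f' c' where n: "n \<in> P" "f' \<in> F" "c' \<in> C" "k \<otimes> f \<otimes> c = h \<otimes> n \<otimes> f' \<otimes> c'"
        unfolding star_def by blast
      have car': "n \<in> carrier G" "n \<in> H" "f' \<in> S s" "f' \<in> carrier G" "c' \<in> carrier G"
        using n F P S_carrier C_carrier by (auto simp: M_def)
      define m where "m = inv n \<otimes> inv h \<otimes> k"
      have m: "m \<in> H" "m \<in> carrier G" using car' that by (auto simp: m_def)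
      have "m \<otimes> (f \<otimes> c) = inv n \<otimes> inv h \<otimes> (k \<otimes> f \<otimes> c)" using car car' by (simp add: m_def m_assoc)
      also have "\<dots> = f' \<otimes> c'" using car car' by (simp add: n(4) m_assoc)
      finally have mf: "m \<otimes> (f \<otimes> c) = f' \<otimes> c'" .
      hence mf': "f' = m \<otimes> (f \<otimes> (c \<otimes> inv c'))" using m car car' by (metis inv_closed m_assoc m_closed r_inv r_one)
      have "m = f' \<otimes> c' \<otimes> inv (f \<otimes> c)" using mf m car by (metis inv_closed m_assoc m_closed r_inv r_one)
      moreover have "c \<in> S s" "c' \<in> S s" using n(3) that(5) C_S by auto
      ultimately have "m \<in> S s"
        using car(1) car'(3) by (simp add: subgroup.m_closed[OF subS] subgroup.m_inv_closed[OF subS])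
      hence mM: "m \<in> M" using m by (simp add: M_def)
      have "c \<otimes> inv c' \<in> C" using n(3) that(5) subC by (meson subgroup.m_closed subgroup.m_inv_closed)
      hence "f' \<in> double_coset G M f C" unfolding mem_double_coset using mf' mM by blast
      hence "double_coset G M f' C = double_coset G M f C" using double_coset_eqI[OF M subC car(2)] by blast
      hence ff: "f' = f" using F(3) n(2) that(4) by (auto dest: inj_onD)
      have "inv f \<otimes> m \<otimes> f = inv f \<otimes> (m \<otimes> (f \<otimes> c)) \<otimes> inv c" using m car by (simp add: m_assoc)
      also have "\<dots> = c' \<otimes> inv c" using mf ff car car' by (simp add: m_assoc)
      finally have "inv f \<otimes> m \<otimes> f \<in> C" using n(3) that(5) subC by (metis subgroup.m_closed subgroup.m_inv_closed)
      hence "m \<in> stab G H C f" using m by (simp add: stab_def)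
      hence "m \<in> generate G (NF f)" using NF that(4) by blast
      also have "\<dots> \<subseteq> P" using NF P that(4) by (intro generate_subgroup_incl) (auto simp: N1_def)
      finally have "n \<otimes> m \<in> P" using n(1) P(1) by (meson subgroup.m_closed)
      moreover have "n \<otimes> m = inv h \<otimes> k" using car car' by (simp add: m_def m_assoc)
      ultimately show "inv h \<otimes> k \<in> P" by simp
    qed
  qed
  have star_coset: "inv h \<otimes> x \<in> S s" if st: "star P h x" and "h \<in> H" "P \<subseteq> M" for P h x
  proof -
    obtain n f c where n: "n \<in> P" "f \<in> F" "c \<in> C" "x = h \<otimes> n \<otimes> f \<otimes> c"
      using st unfolding star_def by blast
    have "n \<in> S s" "f \<in> S s" "c \<in> S s" using n that F C_S by (auto simp: M_def)
    moreover from this have "inv h \<otimes> x = n \<otimes> f \<otimes> c" using n(4) \<open>h \<in> H\<close> S_carrier by (simp add: m_assoc)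
    ultimately show ?thesis using subS by (metis subgroup.m_closed)
  qed
  \<comment> \<open>For \<open>t = s\<close> this is adjacency in the split graph; the condition holds trivially at a vertex outside the \<open>H\<close>-orbit of \<open>S s\<close>.\<close>
  define RR where "RR P t x y \<longleftrightarrow> x \<in> U \<and> y \<in> U \<and> same_coset G (S t) x y \<and>
      (t = s \<longrightarrow> (\<forall>h\<in>H. star P h x \<longleftrightarrow> star P h y))" for P t x y
  \<comment> \<open>Each path survives the splitting once \<open>P\<close> contains the element of \<open>M\<close> by which each of its steps turns.\<close>
  have path: "\<exists>N. finite N \<and> N \<subseteq> M \<and> (\<forall>P. good P \<longrightarrow> N \<subseteq> P \<longrightarrow> (\<lambda>d e. \<exists>t. RR P t d e)\<^sup>*\<^sup>* x y)"
    if "(adjacent U)\<^sup>*\<^sup>* x y" for x y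
    using that
  proof (induction rule: rtranclp_induct)
    case base
    show ?case by (intro exI[of _ "{}"]) auto
  next
    case (step y z)
    obtain N where N: "finite N" "N \<subseteq> M"
      "\<And>P. good P \<Longrightarrow> N \<subseteq> P \<Longrightarrow> (\<lambda>d e. \<exists>t. RR P t d e)\<^sup>*\<^sup>* x y" using step.IH by blast
    obtain t where t: "same_coset G (S t) y z" and yz: "y \<in> U" "z \<in> U"
      using step.hyps(2) by (auto simp: adjacent_def)
    have yzc: "y \<in> carrier G" "z \<in> carrier G" using yz Uc by auto
    have "\<exists>n\<in>M. \<forall>P. good P \<longrightarrow> n \<in> P \<longrightarrow> (\<exists>t. RR P t y z)"
    proof (cases "t = s")
      case False
      hence "RR P t y z" for P using t yz by (simp add: RR_def)
      thus ?thesis using M.one_closed by blast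
    next
      case ts: True
      show ?thesis
      proof (cases "\<exists>h\<in>H. inv h \<otimes> y \<in> S s")
        case False
        have "inv h \<otimes> z \<notin> S s" if h: "h \<in> H" for h
        proof
          assume "inv h \<otimes> z \<in> S s"
          moreover have "inv z \<otimes> y \<in> S s"
            using same_coset_sym[OF subS t] ts by (simp add: same_coset_def)
          ultimately have "inv h \<otimes> z \<otimes> (inv z \<otimes> y) \<in> S s" by (rule subgroup.m_closed[OF subS])
          moreover have "inv h \<otimes> z \<otimes> (inv z \<otimes> y) = inv h \<otimes> y" using h yzc by (simp add: m_assoc)
          ultimately show False using False h by simp
        qed
        hence "RR P s y z" if "good P" for P
          using star_coset False that t ts yz unfolding RR_def good_def by blast
        thus ?thesis using M.one_closed by blast
      next
        case True
        then obtain h where h: "h \<in> H" "inv h \<otimes> y \<in> S s" by blast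
        have "inv h \<otimes> y \<otimes> (inv y \<otimes> z) \<in> S s"
          using h t ts subgroup.m_closed[OF subS] by (simp add: same_coset_def)
        hence hz: "inv h \<otimes> z \<in> S s" using h yzc by (simp add: m_assoc)
        obtain m f c where m: "m \<in> M" "f \<in> F" "c \<in> C" "inv h \<otimes> y = m \<otimes> f \<otimes> c"
          using reps[OF h(2)] UH h yz by blast
        obtain m' f' c' where m': "m' \<in> M" "f' \<in> F" "c' \<in> C" "inv h \<otimes> z = m' \<otimes> f' \<otimes> c'"
          using reps[OF hz] UH h yz by blast
        have car: "f \<in> carrier G" "f' \<in> carrier G" "c \<in> carrier G" "c' \<in> carrier G" "h \<in> carrier G"
          using m m' h F S_carrier C_carrier by auto
        have "h \<otimes> (inv h \<otimes> y) = y" "h \<otimes> (inv h \<otimes> z) = z" using car yzc by simp_all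
        hence yz_eq: "y = h \<otimes> m \<otimes> f \<otimes> c" "z = h \<otimes> m' \<otimes> f' \<otimes> c'"
          unfolding m(4) m'(4) using m(1) m'(1) car by (simp_all add: m_assoc)
        have hm: "h \<otimes> m \<in> H" "h \<otimes> m' \<in> H" using h m m' by (auto simp: M_def)
        have "RR P s y z" if P: "good P" "inv m \<otimes> m' \<in> P" for P
        proof -
          have sP: "subgroup P G" using P by (simp add: good_def)
          have "star P k y \<longleftrightarrow> star P k z" if k: "k \<in> H" for k
          proof -
            have 1: "inv k \<otimes> (h \<otimes> m') = inv k \<otimes> (h \<otimes> m) \<otimes> (inv m \<otimes> m')"
              and 2: "inv k \<otimes> (h \<otimes> m) = inv k \<otimes> (h \<otimes> m') \<otimes> inv (inv m \<otimes> m')"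
              using k h m m' by (simp_all add: group_norm)
            have "inv k \<otimes> (h \<otimes> m) \<in> P \<longleftrightarrow> inv k \<otimes> (h \<otimes> m') \<in> P"
              using 1 2 P(2) sP by (metis subgroup.m_closed subgroup.m_inv_closed)
            thus ?thesis unfolding yz_eq
              using star_iff[OF P(1) k hm(1) m(2,3)] star_iff[OF P(1) k hm(2) m'(2,3)] by simp
          qed
          thus ?thesis using t ts yz by (simp add: RR_def)
        qed
        moreover have "inv m \<otimes> m' \<in> M" using m m' by simp
        ultimately show ?thesis by blast
      qed
    qed
    then obtain n where n: "n \<in> M" "\<And>P. good P \<Longrightarrow> n \<in> P \<Longrightarrow> \<exists>t. RR P t y z" by blast
    show ?case
    proof (intro exI[of _ "insert n N"] conjI allI impI)
      show "finite (insert n N)" "insert n N \<subseteq> M" using N n by auto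
      fix P assume P: "good P" "insert n N \<subseteq> P"
      show "(\<lambda>d e. \<exists>t. RR P t d e)\<^sup>*\<^sup>* x z"
        by (rule rtranclp.rtrancl_into_rtrancl[of _ x y]) (use N(3) n(2) P in auto)
    qed
  qed
  obtain T where T: "finite T" "T \<subseteq> carrier G" "H = generate G T"
    using fgH by (auto simp: fg_subgroup_def)
  have TH: "T \<subseteq> H" using T(3) generate.incl by fast
  have HU: "h \<in> U" if "h \<in> H" for h using UH[OF that oneU] that by simp
  have "\<forall>x\<in>T. \<exists>N. finite N \<and> N \<subseteq> M \<and> (\<forall>P. good P \<longrightarrow> N \<subseteq> P \<longrightarrow> (\<lambda>d e. \<exists>t. RR P t d e)\<^sup>*\<^sup>* \<one> x)"
  proof
    fix x assume "x \<in> T"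
    hence "x \<in> U" using TH HU by blast
    hence "(adjacent U)\<^sup>*\<^sup>* \<one> x" using Q(4) oneU unfolding connected_in_def U_def[symmetric] by blast
    thus "\<exists>N. finite N \<and> N \<subseteq> M \<and> (\<forall>P. good P \<longrightarrow> N \<subseteq> P \<longrightarrow> (\<lambda>d e. \<exists>t. RR P t d e)\<^sup>*\<^sup>* \<one> x)"
      by (rule path)
  qed
  then obtain NT where NT: "\<And>x. x \<in> T \<Longrightarrow> finite (NT x) \<and> NT x \<subseteq> M \<and>
      (\<forall>P. good P \<longrightarrow> NT x \<subseteq> P \<longrightarrow> (\<lambda>d e. \<exists>t. RR P t d e)\<^sup>*\<^sup>* \<one> x)" by metis
  \<comment> \<open>The edge of \<open>\<one>\<close> need not be its own representative; \<open>m0\<close> accounts for the difference.\<close>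
  obtain m0 f0 c0 where m0: "m0 \<in> M" "f0 \<in> F" "c0 \<in> C" "\<one> = m0 \<otimes> f0 \<otimes> c0"
    using reps[OF _ oneU] subgroup.one_closed[OF subS] by blast
  define N where "N = insert m0 (N1 \<union> (\<Union>x\<in>T. NT x))"
  define P where "P = generate G N"
  have N: "finite N" "N \<subseteq> M" using N1 NT T(1) m0 by (auto simp: N_def)
  have Nc: "N \<subseteq> carrier G" using N M.subset by blast
  have NP: "N \<subseteq> P" unfolding P_def using generate.incl by fast
  have P: "subgroup P G" unfolding P_def by (rule generate_is_subgroup[OF Nc])
  have PM: "P \<subseteq> M" unfolding P_def by (rule generate_subgroup_incl[OF N(2) M])
  have goodP: "good P" using P PM NP by (auto simp: good_def N_def)
  interpret folding G S C "RR P" "\<lambda>x. x"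
  proof
    show "RR P t e d" if "RR P t d e" for t d e
      using that same_coset_sym[OF subS] by (auto simp: RR_def)
    show "RR P t d f" if "RR P t d e" "RR P t e f" for t d e f
      using that same_coset_trans[OF subS] by (auto simp: RR_def)
    show "same_coset G (S t) d e" if "RR P t d e" for t d e using that by (simp add: RR_def)
    show "RR P (\<not> t) d e" if r: "RR P t d e" and c: "same_coset G C d e" for t d e
    proof -
      have star_C: "star P h y" if st: "star P h x" and xy: "same_coset G C x y" and h: "h \<in> H" for h x y
      proof -
        obtain n f c where n: "n \<in> P" "f \<in> F" "c \<in> C" "x = h \<otimes> n \<otimes> f \<otimes> c"
      using st unfolding star_def by blast
        obtain c' where c': "c' \<in> C" "y = x \<otimes> c'" using xy by (metis same_cosetE)
        have "n \<in> carrier G" "f \<in> carrier G" using n PM F S_carrier by auto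
        hence "y = h \<otimes> n \<otimes> f \<otimes> (c \<otimes> c')" using n c' h C_carrier by (simp add: m_assoc)
        thus ?thesis unfolding star_def using n c' subgroup.m_closed[OF subC] by blast
      qed
      have "star P h d \<longleftrightarrow> star P h e" if "h \<in> H" for h
        using star_C[OF _ c that] star_C[OF _ same_coset_sym[OF subC c] that] by blast
      thus ?thesis using r same_coset_mono[OF C_S c] by (simp add: RR_def)
    qed
  qed
  have RR_left: "RR P t (g \<otimes> x) (g \<otimes> y)" if g: "g \<in> H" and r: "RR P t x y" for t g x y
  proof -
    have "star P h (g \<otimes> z) \<longleftrightarrow> star P (inv g \<otimes> h) z" if "h \<in> H" "z \<in> U" for h z
    proof -
      have "g \<otimes> z = h \<otimes> n \<otimes> f \<otimes> c \<longleftrightarrow> z = inv g \<otimes> h \<otimes> n \<otimes> f \<otimes> c"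
        if "n \<in> P" "f \<in> F" "c \<in> C" for n f c
      proof -
        have "n \<in> carrier G" "f \<in> carrier G" "c \<in> carrier G" "z \<in> carrier G"
          using that PM F S_carrier C_carrier \<open>z \<in> U\<close> Uc by auto
        thus ?thesis using g \<open>h \<in> H\<close> by (auto simp: m_assoc) (metis H.mem_carrier inv_cancel_left(1))
      qed
      thus ?thesis unfolding star_def by blast
    qed
    moreover have "same_coset G (S t) (g \<otimes> x) (g \<otimes> y)" using r g same_coset_mult_left by (auto simp: RR_def)
    ultimately show ?thesis using r g UH by (auto simp: RR_def)
  qed
  have path_left: "(\<lambda>d e. \<exists>t. RR P t d e)\<^sup>*\<^sup>* (g \<otimes> x) (g \<otimes> y)"
    if "g \<in> H" "(\<lambda>d e. \<exists>t. RR P t d e)\<^sup>*\<^sup>* x y" for g x y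
    using that(2)
  proof (induction rule: rtranclp_induct)
    case (step y z)
    hence "\<exists>t. RR P t (g \<otimes> y) (g \<otimes> z)" using RR_left that(1) by blast
    with step.IH show ?case by (rule rtranclp.rtrancl_into_rtrancl)
  qed simp
  have path_sym: "(\<lambda>d e. \<exists>t. RR P t d e)\<^sup>*\<^sup>* y x" if "(\<lambda>d e. \<exists>t. RR P t d e)\<^sup>*\<^sup>* x y" for x y
    by (rule sympD[OF symp_rtranclp that]) (auto intro!: sympI dest: RR_sym)
  have gen_path: "(\<lambda>d e. \<exists>t. RR P t d e)\<^sup>*\<^sup>* \<one> x" if "x \<in> T" for x
  proof -
    have "NT x \<subseteq> P" using NP that by (auto simp: N_def)
    thus ?thesis using NT[OF that] goodP by blast
  qed
  have H_path: "(\<lambda>d e. \<exists>t. RR P t d e)\<^sup>*\<^sup>* \<one> h" if "h \<in> H" for h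
  proof -
    have "h \<in> generate G T" using that T by simp
    thus ?thesis
    proof (induction rule: generate.induct)
      case (inv x)
      hence x: "x \<in> H" "x \<in> carrier G" using TH by auto
      hence "(\<lambda>d e. \<exists>t. RR P t d e)\<^sup>*\<^sup>* (inv x \<otimes> \<one>) (inv x \<otimes> x)"
        by (intro path_left gen_path inv) auto
      thus ?case using path_sym x by simp
    next
      case (eng g h)
      hence g: "g \<in> H" "h \<in> H" using T by auto
      have "(\<lambda>d e. \<exists>t. RR P t d e)\<^sup>*\<^sup>* (g \<otimes> \<one>) (g \<otimes> h)" by (intro path_left g eng)
      thus ?case using eng.IH(1) g by (auto intro: rtranclp_trans)
    qed (auto intro: gen_path)
  qed
  have "M \<subseteq> P"
  proof
    fix h assume h: "h \<in> M"
    hence hH: "h \<in> H" "h \<in> S s" by (auto simp: M_def)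
    have "RR P s h h" using HU hH same_coset_refl[OF subS] by (auto simp: RR_def)
    moreover have "same_coset G (S s) \<one> h" using hH by (simp add: same_coset_def)
    ultimately have RR: "RR P s \<one> h" using locally_injective_imp_injective[OF H_path[OF hH(1)]] by blast
    have "m0 \<in> P" using NP by (auto simp: N_def)
    moreover have "m0 \<in> H" using m0(1) by (simp add: M_def)
    ultimately have "star P \<one> (m0 \<otimes> f0 \<otimes> c0)"
      using star_iff[OF goodP H.one_closed _ m0(2,3), of m0] by simp
    hence "star P \<one> \<one>" unfolding m0(4)[symmetric] .
    hence "star P \<one> h" using RR H.one_closed by (auto simp: RR_def)
    moreover have f0: "f0 \<in> carrier G" "c0 \<in> carrier G" "m0 \<in> H"
      using m0 F S_carrier C_carrier by (auto simp: M_def)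
    have "h = h \<otimes> (m0 \<otimes> f0 \<otimes> c0)" using m0(4) hH by (metis H.mem_carrier r_one)
    hence "h = h \<otimes> m0 \<otimes> f0 \<otimes> c0" using hH f0 by (simp add: m_assoc)
    ultimately have "star P \<one> (h \<otimes> m0 \<otimes> f0 \<otimes> c0)" by simp
    hence "inv \<one> \<otimes> (h \<otimes> m0) \<in> P"
      using star_iff[OF goodP H.one_closed _ m0(2,3), of "h \<otimes> m0"] hH f0 by blast
    hence "h \<otimes> m0 \<otimes> inv m0 \<in> P"
      using NP P hH f0 by (simp add: N_def subgroup.m_closed subgroup.m_inv_closed)
    thus "h \<in> P" using hH f0 by (simp add: m_assoc)
  qed
  hence "H \<inter> S s = generate G N" using PM by (auto simp: M_def P_def)
  thus ?thesis using N(1) Nc by (auto simp: fg_subgroup_def)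
qed

text \<open>Generators of \<open>J\<close> are those of the vertex stabilisers at the representatives \<open>y \<in> Y\<close>, together with, for each pair of
representatives, one element of \<open>J\<close> that carries the second to an edge sharing a vertex with the first, if such an
element exists. Let \<open>L\<close> be the subgroup generated. An edge adjacent to one in \<open>L <#> Y <#> C\<close> is again in this set, which by
connectedness is therefore all of \<open>Z\<close>.\<close>

theorem fg_of_cofinite_action:
  assumes J: "subgroup J G" and Z: "connected_in Z" "Z \<subseteq> carrier G" "Z \<noteq> {}"
    and JZ: "\<And>j z. j \<in> J \<Longrightarrow> z \<in> Z \<Longrightarrow> j \<otimes> z \<in> Z"
    and Y: "finite Y" "Y \<subseteq> carrier G" "Y \<subseteq> Z" "Z \<subseteq> J <#> Y <#> C"
    and fg: "\<And>y s. y \<in> Y \<Longrightarrow> fg_subgroup (conj_subgroup G J y \<inter> S s) G"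
  shows "fg_subgroup J G"
proof -
  interpret J: subgroup J G by (rule J)
  have "\<exists>N. finite N \<and> N \<subseteq> carrier G \<and> stab G J (S s) y = generate G N" if "y \<in> Y" for s y
    using fg_stab[OF J.subset _ fg[OF that]] Y(2) that by (auto simp: fg_subgroup_def)
  hence "\<forall>s. \<exists>N. \<forall>y\<in>Y. finite (N y) \<and> N y \<subseteq> carrier G \<and> stab G J (S s) y = generate G (N y)"
    by (intro allI bchoice) blast
  from choice[OF this] obtain N where
    N: "\<And>s y. y \<in> Y \<Longrightarrow> finite (N s y) \<and> N s y \<subseteq> carrier G \<and> stab G J (S s) y = generate G (N s y)"
    by blast
  define tr where "tr s y y' = (SOME j. j \<in> J \<and> inv y \<otimes> j \<otimes> y' \<in> S s)" for s y y'
  define E where "E = {(s, y, y'). y \<in> Y \<and> y' \<in> Y \<and> (\<exists>j. j \<in> J \<and> inv y \<otimes> j \<otimes> y' \<in> S s)}"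
  have tr: "tr s y y' \<in> J \<and> inv y \<otimes> tr s y y' \<otimes> y' \<in> S s" if "(s, y, y') \<in> E" for s y y'
  proof -
    have "\<exists>j. j \<in> J \<and> inv y \<otimes> j \<otimes> y' \<in> S s" using that unfolding E_def by blast
    thus ?thesis unfolding tr_def by (rule someI_ex)
  qed
  have "E \<subseteq> UNIV \<times> Y \<times> Y" by (auto simp: E_def)
  hence finE: "finite E" using Y(1) by (meson finite finite_SigmaI finite_subset)
  define T where "T = (\<Union>s. \<Union>y\<in>Y. N s y) \<union> (\<lambda>(s, y, y'). tr s y y') ` E"
  define L where "L = generate G T"
  have "finite T" using Y(1) N finE by (auto simp: T_def)
  have NJ: "N s y \<subseteq> J" if "y \<in> Y" for s y
  proof -
    have "N s y \<subseteq> generate G (N s y)" using generate.incl by fast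
    also have "\<dots> \<subseteq> J" using N[OF that, of s] by (auto simp: stab_def)
    finally show ?thesis .
  qed
  have TJ: "T \<subseteq> J" using NJ tr by (auto simp: T_def)
  have Tc: "T \<subseteq> carrier G" using TJ J.subset by blast
  have L: "subgroup L G" unfolding L_def by (rule generate_is_subgroup[OF Tc])
  have LJ: "L \<subseteq> J" unfolding L_def by (rule generate_subgroup_incl[OF TJ J])
  \<comment> \<open>Two elements of \<open>J\<close> that carry \<open>y'\<close> to edges at the same vertex of \<open>y\<close> differ by an element of its stabiliser.\<close>
  have key: "j \<in> L" if j: "j \<in> J" "y \<in> Y" "y' \<in> Y" "inv y \<otimes> j \<otimes> y' \<in> S s" for j y y' s
  proof -
    let ?t = "tr s y y'"
    have "(s, y, y') \<in> E" using j by (auto simp: E_def)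
    hence t: "?t \<in> J" "inv y \<otimes> ?t \<otimes> y' \<in> S s" "?t \<in> L"
      using tr unfolding L_def T_def by (auto intro!: generate.incl rev_image_eqI)
    have car: "j \<in> carrier G" "y \<in> carrier G" "y' \<in> carrier G" "?t \<in> carrier G" using j t Y by auto
    have "inv y \<otimes> j \<otimes> y' \<otimes> inv (inv y \<otimes> ?t \<otimes> y') \<in> S s"
      using j t subS by (meson subgroup.m_closed subgroup.m_inv_closed)
    hence "inv y \<otimes> (j \<otimes> inv ?t) \<otimes> y \<in> S s" using car by (simp add: group_norm)
    hence "j \<otimes> inv ?t \<in> stab G J (S s) y" using j t by (simp add: stab_def)
    hence "j \<otimes> inv ?t \<in> generate G (N s y)" using N j by blast
    moreover have "generate G (N s y) \<subseteq> L" unfolding L_def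
      using j by (intro mono_generate) (auto simp: T_def)
    ultimately have "j \<otimes> inv ?t \<otimes> ?t \<in> L" using t L by (meson subgroup.m_closed subsetD)
    thus ?thesis using car by (simp add: m_assoc)
  qed
  obtain z0 where "z0 \<in> J <#> Y <#> C" using Z(3) Y(4) by blast
  then obtain y0 where y0: "y0 \<in> Y" unfolding mem_hull by blast
  have y0c: "y0 \<in> carrier G" using y0 Y by auto
  have reach: "\<exists>l\<in>L. \<exists>y\<in>Y. \<exists>c\<in>C. z = l \<otimes> y \<otimes> c" if "(adjacent Z)\<^sup>*\<^sup>* y0 z" for z
    using that
  proof (induction rule: rtranclp_induct)
    case base
    have "y0 = \<one> \<otimes> y0 \<otimes> \<one>" using y0c by simp
    thus ?case using y0 subgroup.one_closed[OF L] subgroup.one_closed[OF subC] by blast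
  next
    case (step z z')
    obtain l y c where l: "l \<in> L" "y \<in> Y" "c \<in> C" "z = l \<otimes> y \<otimes> c" using step.IH by blast
    obtain s where s: "same_coset G (S s) z z'" "z' \<in> Z" using step.hyps(2) by (auto simp: adjacent_def)
    obtain j y' c' where j: "j \<in> J" "y' \<in> Y" "c' \<in> C" "z' = j \<otimes> y' \<otimes> c'"
      using subsetD[OF Y(4) s(2)] unfolding mem_hull by blast
    have car: "l \<in> carrier G" "l \<in> J" "y \<in> carrier G" "c \<in> carrier G" "j \<in> carrier G" "y' \<in> carrier G" "c' \<in> carrier G"
      using l j LJ Y C_carrier by auto
    have "c \<otimes> (inv z \<otimes> z') \<otimes> inv c' \<in> S s"
      using s l j C_S subS unfolding same_coset_def by (meson subgroup.m_closed subgroup.m_inv_closed subsetD)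
    moreover have "c \<otimes> (inv z \<otimes> z') \<otimes> inv c' = inv y \<otimes> (inv l \<otimes> j) \<otimes> y'"
      using car by (simp add: l(4) j(4) group_norm)
    ultimately have "inv l \<otimes> j \<in> L" using key[of "inv l \<otimes> j" y y' s] l j car by simp
    hence "l \<otimes> (inv l \<otimes> j) \<in> L" using l L by (meson subgroup.m_closed)
    hence "j \<in> L" using car by simp
    thus ?case using j by blast
  qed
  have "J \<subseteq> L"
  proof
    fix j assume j: "j \<in> J"
    have "(adjacent Z)\<^sup>*\<^sup>* y0 (j \<otimes> y0)"
      using Z(1) JZ[OF j] y0 Y(3) unfolding connected_in_def by blast
    then obtain l y c where l: "l \<in> L" "y \<in> Y" "c \<in> C" "j \<otimes> y0 = l \<otimes> y \<otimes> c" using reach by blast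
    have car: "l \<in> carrier G" "l \<in> J" "y \<in> carrier G" "c \<in> carrier G" "j \<in> carrier G"
      using l j LJ Y C_carrier by auto
    have "inv y \<otimes> (inv l \<otimes> j) \<otimes> y0 = inv y \<otimes> (inv l \<otimes> (j \<otimes> y0))" using car y0c by (simp add: m_assoc)
    also have "\<dots> = c" using car by (simp add: l(4) m_assoc)
    finally have "inv y \<otimes> (inv l \<otimes> j) \<otimes> y0 \<in> S True" using l(3) C_S by auto
    hence "inv l \<otimes> j \<in> L" using key[of "inv l \<otimes> j" y y0 True] l y0 j car by simp
    hence "l \<otimes> (inv l \<otimes> j) \<in> L" using l L by (meson subgroup.m_closed)
    thus "j \<in> L" using car by simp
  qed
  hence "J = generate G T" using LJ L_def by blast
  thus ?thesis using \<open>finite T\<close> Tc by (auto simp: fg_subgroup_def)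
qed

text \<open>The edges of \<open>Z\<close> whose vertex over \<open>S s\<close> is not a leaf of \<open>Z\<close>.\<close>

definition branching :: "bool \<Rightarrow> 'a set \<Rightarrow> 'a set" where
  "branching s Z = {z \<in> Z. \<exists>y\<in>Z. same_coset G (S s) z y \<and> \<not> same_coset G C z y}"

text \<open>A path that enters a leaf through its only edge has to leave through the same edge, so a path between elements of \<open>W\<close> can
be replaced by one that avoids the edges at leaves.\<close>

lemma connected_in_prune:
  assumes Z: "connected_in Z" "Z \<subseteq> carrier G" and W: "branching s Z \<subseteq> W" "W \<subseteq> Z"
  shows "connected_in W"
  unfolding connected_in_def
proof (intro ballI)
  fix x y assume xy: "x \<in> W" "y \<in> W"
  note sc = same_coset_sym[OF subS] same_coset_trans[OF subS]
  \<comment> \<open>The path is followed by its last edge in \<open>W\<close>, which shares the vertex over the other factor with the current edge.\<close>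
  have inv: "\<exists>z'\<in>W. (adjacent W)\<^sup>*\<^sup>* x z' \<and> same_coset G (S (\<not> s)) z' z"
    if "(adjacent Z)\<^sup>*\<^sup>* x z" for z
    using that
  proof (induction rule: rtranclp_induct)
    case base
    have "same_coset G (S (\<not> s)) x x" using xy W Z by (intro same_coset_refl[OF subS]) auto
    thus ?case using xy by blast
  next
    case (step z u)
    obtain z' where z': "z' \<in> W" "(adjacent W)\<^sup>*\<^sup>* x z'" "same_coset G (S (\<not> s)) z' z"
      using step.IH by blast
    have zu: "z \<in> Z" "u \<in> Z" "\<exists>t. same_coset G (S t) z u" using step.hyps(2) by (auto simp: adjacent_def)
    show ?case
    proof (cases "same_coset G (S (\<not> s)) z u")
      case True
      thus ?thesis using z' sc by blast
    next
      case False
      from zu(3) obtain t where t: "same_coset G (S t) z u" by blast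
      with False have "t \<noteq> (\<not> s)" by blast
      with t have s: "same_coset G (S s) z u" by (cases t; cases s) auto
      have C: "\<not> same_coset G C z u" using False same_coset_mono[OF C_S] by blast
      hence "\<not> same_coset G C u z" using same_coset_sym[OF subC] by blast
      hence br: "z \<in> W" "u \<in> W" using W(1) zu s C sc unfolding branching_def by blast+
      have "adjacent W z' z" "adjacent W z u" using br z' s by (auto simp: adjacent_def)
      hence "(adjacent W)\<^sup>*\<^sup>* x u" using z'(2) by (meson rtranclp.rtrancl_into_rtrancl)
      moreover have "same_coset G (S (\<not> s)) u u" using zu Z by (intro same_coset_refl[OF subS]) auto
      ultimately show ?thesis using br by blast
    qed
  qed
  have "(adjacent Z)\<^sup>*\<^sup>* x y" using Z(1) xy W(2) unfolding connected_in_def by blast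
  then obtain z' where z': "z' \<in> W" "(adjacent W)\<^sup>*\<^sup>* x z'" "same_coset G (S (\<not> s)) z' y" using inv by blast
  hence "adjacent W z' y" using xy by (auto simp: adjacent_def)
  thus "(adjacent W)\<^sup>*\<^sup>* x y" using z'(2) by (meson rtranclp.rtrancl_into_rtrancl)
qed

end

section \<open>Edges at a vertex of the intersection of two subtrees\<close>

text \<open>All fibres over \<open>D\<close> of the maps \<open>q\<close> for \<open>f \<in> \<F>\<close> and \<open>g \<in> \<G>\<close>, as a disjoint union.\<close>

definition fibres ::
  "('a, 'm) monoid_scheme \<Rightarrow> 'a set \<Rightarrow> 'a set \<Rightarrow> 'a set \<Rightarrow> 'a set \<Rightarrow> 'a set \<Rightarrow> 'a set \<Rightarrow> ('a \<times> 'a \<times> 'a set) set" where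
  "fibres G A B C \<F> \<G> D = (SIGMA f:\<F>. SIGMA g:\<G>. dc_fibre G A B C f g D)"

text \<open>A family of extended naturals with finite sum has finite entries, almost all of them zero. Here the entry at \<open>D\<close> is
one less than the size of the disjoint union of the fibres over \<open>D\<close>.\<close>

lemma fcip_rel_finite_fibres:
  assumes "fcip_rel G A" "fg_subgroup B G" "fg_subgroup C G"
    and \<F>: "finite \<F>" "\<F> \<subseteq> carrier G" "inj_on (\<lambda>f. double_coset G B f A) \<F>"
    and \<G>: "finite \<G>" "\<G> \<subseteq> carrier G" "inj_on (\<lambda>g. double_coset G C g A) \<G>"
  shows "D \<in> double_cosets G B C \<Longrightarrow> finite (fibres G A B C \<F> \<G> D)"
    and "finite {D \<in> double_cosets G B C. \<exists>t\<in>fibres G A B C \<F> \<G> D. \<exists>u\<in>fibres G A B C \<F> \<G> D. t \<noteq> u}"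
proof -
  define n where "n D = (\<Sum>f\<in>\<F>. \<Sum>g\<in>\<G>. ecard (dc_fibre G A B C f g D))" for D
  have inf: "(\<Sum>\<^sub>\<infinity>D\<in>double_cosets G B C. n D - 1) < \<infinity>"
    using assms unfolding fcip_rel_def n_def by blast
  have n_fin: "n D < \<infinity>" if "D \<in> double_cosets G B C" for D
    using infsum_enat_finite(2)[OF inf that] by (cases "n D") auto
  have fin: "finite (fibres G A B C \<F> \<G> D)" "n D = enat (card (fibres G A B C \<F> \<G> D))"
    if D: "D \<in> double_cosets G B C" for D
  proof -
    have *: "finite (dc_fibre G A B C f g D)" if fg: "f \<in> \<F>" "g \<in> \<G>" for f g
    proof -
      have "ecard (dc_fibre G A B C f g D) \<le> (\<Sum>g\<in>\<G>. ecard (dc_fibre G A B C f g D))"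
        using fg \<G>(1) by (intro member_le_sum) auto
      also have "\<dots> \<le> n D" unfolding n_def
        using fg \<F>(1) by (intro member_le_sum[of f \<F> "\<lambda>f. \<Sum>g\<in>\<G>. ecard (dc_fibre G A B C f g D)"]) auto
      also have "\<dots> < \<infinity>" by (rule n_fin[OF D])
      finally show ?thesis by (auto simp: ecard_def split: if_splits)
    qed
    thus "finite (fibres G A B C \<F> \<G> D)" unfolding fibres_def
      by (intro finite_SigmaI \<F>(1) \<G>(1))
    have "n D = (\<Sum>f\<in>\<F>. \<Sum>g\<in>\<G>. enat (card (dc_fibre G A B C f g D)))"
      unfolding n_def using * by (intro sum.cong HOL.refl) (simp add: ecard_def)
    also have "\<dots> = enat (\<Sum>f\<in>\<F>. \<Sum>g\<in>\<G>. card (dc_fibre G A B C f g D))"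
      by (simp add: of_nat_eq_enat[symmetric])
    also have "(\<Sum>f\<in>\<F>. \<Sum>g\<in>\<G>. card (dc_fibre G A B C f g D)) = card (fibres G A B C \<F> \<G> D)"
      unfolding fibres_def using * \<F>(1) \<G>(1) by (subst card_SigmaI) (auto simp: card_SigmaI)
    finally show "n D = enat (card (fibres G A B C \<F> \<G> D))" .
  qed
  show "finite (fibres G A B C \<F> \<G> D)" if "D \<in> double_cosets G B C" using fin that by blast
  have "n D - 1 \<noteq> 0" if D: "D \<in> double_cosets G B C" "t \<in> fibres G A B C \<F> \<G> D"
      "u \<in> fibres G A B C \<F> \<G> D" "t \<noteq> u" for D t u
  proof -
    have "card {t, u} \<le> card (fibres G A B C \<F> \<G> D)" using D fin(1)[OF D(1)] by (intro card_mono) auto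
    hence "2 \<le> card (fibres G A B C \<F> \<G> D)" using D(4) by simp
    thus ?thesis using fin(2)[OF D(1)] by (simp add: one_enat_def zero_enat_def)
  qed
  hence "{D \<in> double_cosets G B C. \<exists>t\<in>fibres G A B C \<F> \<G> D. \<exists>u\<in>fibres G A B C \<F> \<G> D. t \<noteq> u}
      \<subseteq> {D \<in> double_cosets G B C. n D - 1 \<noteq> 0}" by blast
  thus "finite {D \<in> double_cosets G B C. \<exists>t\<in>fibres G A B C \<F> \<G> D. \<exists>u\<in>fibres G A B C \<F> \<G> D. t \<noteq> u}"
    using infsum_enat_finite(1)[OF inf] finite_subset by blast
qed

context amalgam
begin

text \<open>An edge at the vertex \<open>h q S s\<close> can be written with a representative \<open>f \<in> F\<close>, after \<open>h\<close> has been changed by an element of the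
stabiliser of that vertex.\<close>

lemma ex_edge_rep:
  assumes H: "subgroup H G" and q: "q \<in> carrier G" and F: "F \<subseteq> S s"
    and UH: "\<And>h u. h \<in> H \<Longrightarrow> u \<in> U \<Longrightarrow> h \<otimes> u \<in> U"
    and cover: "\<And>a. a \<in> S s \<Longrightarrow> q \<otimes> a \<in> U \<Longrightarrow>
        \<exists>f\<in>F. a \<in> double_coset G (S s \<inter> conj_subgroup G H q) f C"
    and x: "x \<in> U" "h \<in> H" "a \<in> S s" "x = h \<otimes> q \<otimes> a"
  shows "\<exists>f\<in>F. \<exists>c\<in>C. \<exists>h\<in>H. x = h \<otimes> q \<otimes> f \<otimes> c"
proof -
  interpret H: subgroup H G by (rule H)
  have ac: "a \<in> carrier G" "h \<in> carrier G" using x S_carrier by auto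
  have "inv h \<otimes> x = q \<otimes> a" using ac q by (simp add: x(4) m_assoc)
  hence "q \<otimes> a \<in> U" using UH[of "inv h" x] x by simp
  then obtain f b c where f: "f \<in> F" "b \<in> S s" "b \<in> conj_subgroup G H q" "c \<in> C" "a = b \<otimes> (f \<otimes> c)"
    using cover[OF x(3)] unfolding mem_double_coset by blast
  have car: "f \<in> carrier G" "b \<in> carrier G" "c \<in> carrier G" using f F S_carrier C_carrier by auto
  have "q \<otimes> b \<otimes> inv q \<in> H" using f(3) q H.subset by (simp add: mem_conj_subgroup)
  hence "h \<otimes> (q \<otimes> b \<otimes> inv q) \<in> H" using x by simp
  moreover have "x = h \<otimes> (q \<otimes> b \<otimes> inv q) \<otimes> q \<otimes> f \<otimes> c"
    using car ac q by (simp add: x(4) f(5) m_assoc)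
  ultimately show ?thesis using f by blast
qed

text \<open>Passing from an edge \<open>x\<close> to an edge \<open>y\<close> at the same vertex multiplies \<open>f \<otimes> c\<close> by \<open>inv x \<otimes> y\<close> on the right and, because \<open>h\<close>
may change as well, by an element \<open>b\<close> of the stabiliser of the vertex on the left. As the factor on the right is the same
for \<open>H\<close> and for \<open>K\<close>, it cancels in the double coset that is attached to the vertex.\<close>

lemma edge_reps_same_vertex:
  assumes H: "subgroup H G" and q: "q \<in> carrier G"
    and f: "f \<in> S s" "c \<in> C" "f1 \<in> S s" "c1 \<in> C"
    and x: "h \<in> H" "x = h \<otimes> q \<otimes> f \<otimes> c" and y: "h1 \<in> H" "y = h1 \<otimes> q \<otimes> f1 \<otimes> c1"
    and xy: "same_coset G (S s) x y"
  shows "\<exists>b\<in>S s \<inter> conj_subgroup G H q. f1 \<otimes> c1 = b \<otimes> (f \<otimes> c \<otimes> (inv x \<otimes> y))"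
proof -
  interpret H: subgroup H G by (rule H)
  let ?a = "inv x \<otimes> y"
  have a: "?a \<in> S s" "x \<in> carrier G" "y \<in> carrier G" using xy by (auto simp: same_coset_def)
  have car: "f \<in> carrier G" "c \<in> carrier G" "f1 \<in> carrier G" "c1 \<in> carrier G" "h \<in> carrier G" "h1 \<in> carrier G"
    using f x y S_carrier C_carrier by auto
  define b where "b = inv q \<otimes> (inv h1 \<otimes> h) \<otimes> q"
  have bc: "b \<in> carrier G" using car q by (simp add: b_def)
  have "b \<otimes> (f \<otimes> c \<otimes> ?a) = inv q \<otimes> (inv h1 \<otimes> (h \<otimes> q \<otimes> f \<otimes> c \<otimes> ?a))"
    using car q a by (simp add: b_def m_assoc)
  also have "h \<otimes> q \<otimes> f \<otimes> c \<otimes> ?a = h1 \<otimes> q \<otimes> f1 \<otimes> c1"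
    unfolding x(2)[symmetric] y(2)[symmetric] using a by simp
  finally have eq: "f1 \<otimes> c1 = b \<otimes> (f \<otimes> c \<otimes> ?a)" using car q by (simp add: m_assoc)
  have fca: "f \<otimes> c \<otimes> ?a \<in> S s" "f1 \<otimes> c1 \<in> S s"
    using f C_S a by (auto intro!: subgroup.m_closed[OF subS])
  have "b = f1 \<otimes> c1 \<otimes> inv (f \<otimes> c \<otimes> ?a)"
    unfolding eq using bc fca S_carrier by (simp add: m_assoc)
  hence "b \<in> S s" using fca by (simp add: subgroup.m_closed[OF subS] subgroup.m_inv_closed[OF subS])
  moreover have "q \<otimes> b \<otimes> inv q = inv h1 \<otimes> h" using car q by (simp add: b_def m_assoc)
  hence "b \<in> conj_subgroup G H q" using bc q x(1) y(1) H.subset by (simp add: mem_conj_subgroup)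
  ultimately show ?thesis using eq by blast
qed

text \<open>An edge \<open>h q f c = k r g d\<close> is determined up to \<open>H \<inter> K\<close> by \<open>f\<close>, \<open>g\<close> and the double coset of \<open>c \<otimes> inv d\<close>. Changing
\<open>c \<otimes> inv d\<close> on the left by \<open>u\<close> and on the right by \<open>v\<close> amounts to changing \<open>h\<close> within \<open>H\<close> and \<open>k\<close> within \<open>K\<close>, and the right
factor of the edge by an element \<open>e\<close> of \<open>C\<close>.\<close>

lemma edge_reps_same_class:
  assumes H: "subgroup H G" and K: "subgroup K G" and q: "q \<in> carrier G" "r \<in> carrier G"
    and f: "f \<in> S s" "g \<in> S s" "c \<in> C" "d \<in> C" "c1 \<in> C" "d1 \<in> C"
    and x: "h \<in> H" "x = h \<otimes> q \<otimes> f \<otimes> c" "k \<in> K" "x = k \<otimes> r \<otimes> g \<otimes> d"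
    and y: "h1 \<in> H" "y = h1 \<otimes> q \<otimes> f \<otimes> c1" "k1 \<in> K" "y = k1 \<otimes> r \<otimes> g \<otimes> d1"
    and cl: "c1 \<otimes> inv d1 \<in> double_coset G (C \<inter> conj_subgroup G (S s \<inter> conj_subgroup G H q) f) (c \<otimes> inv d)
                 (C \<inter> conj_subgroup G (S s \<inter> conj_subgroup G K r) g)"
  shows "\<exists>j\<in>H \<inter> K. \<exists>e\<in>C. y = j \<otimes> x \<otimes> e"
proof -
  interpret H: subgroup H G by (rule H)
  interpret K: subgroup K G by (rule K)
  have car: "f \<in> carrier G" "g \<in> carrier G" "c \<in> carrier G" "d \<in> carrier G" "c1 \<in> carrier G" "d1 \<in> carrier G"
    "h \<in> carrier G" "h1 \<in> carrier G" "k \<in> carrier G" "k1 \<in> carrier G"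
    using f x(1,3) y(1,3) S_carrier C_carrier by auto
  obtain u v where uv: "u \<in> C" "u \<in> conj_subgroup G (S s \<inter> conj_subgroup G H q) f" "v \<in> C"
    "v \<in> conj_subgroup G (S s \<inter> conj_subgroup G K r) g" "c1 \<otimes> inv d1 = u \<otimes> (c \<otimes> inv d \<otimes> v)"
    using cl unfolding mem_double_coset by blast
  have uvc: "u \<in> carrier G" "v \<in> carrier G" using uv C_carrier by auto
  have sub: "S s \<inter> conj_subgroup G H q \<subseteq> carrier G" "S s \<inter> conj_subgroup G K r \<subseteq> carrier G"
    using S_carrier by auto
  have u: "q \<otimes> (f \<otimes> u \<otimes> inv f) \<otimes> inv q \<in> H" using uv(2) sub car q H.subset by (simp add: mem_conj_subgroup)
  have v: "r \<otimes> (g \<otimes> v \<otimes> inv g) \<otimes> inv r \<in> K" using uv(4) sub car q K.subset by (simp add: mem_conj_subgroup)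
  define e where "e = inv d \<otimes> v \<otimes> d1"
  have e: "e \<in> C" "e \<in> carrier G" using f uv subC C_carrier unfolding e_def
    by (meson subgroup.m_closed subgroup.m_inv_closed)+
  have "c1 = c1 \<otimes> inv d1 \<otimes> d1" using car by (simp add: m_assoc)
  also have "\<dots> = u \<otimes> c \<otimes> e" unfolding uv(5) e_def using car uvc by (simp add: m_assoc)
  finally have c1: "c1 = u \<otimes> c \<otimes> e" .
  define j where "j = h1 \<otimes> (q \<otimes> (f \<otimes> u \<otimes> inv f) \<otimes> inv q) \<otimes> inv h"
  have jH: "j \<in> H" unfolding j_def using u x(1) y(1) by simp
  have jc: "j \<in> carrier G" using jH by simp
  have jx: "y = j \<otimes> x \<otimes> e"
    unfolding y(2) c1 j_def x(2) using car uvc q e(2) by (simp add: m_assoc)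
  have xc: "x \<in> carrier G" using x(2) car q by simp
  have d1: "d1 \<otimes> inv e = inv v \<otimes> d" unfolding e_def using car uvc by (simp add: group_norm)
  have "j = y \<otimes> inv e \<otimes> inv x" unfolding jx using jc xc e(2) by (simp add: m_assoc)
  also have "\<dots> = k1 \<otimes> r \<otimes> g \<otimes> (d1 \<otimes> inv e) \<otimes> inv x"
    unfolding y(4) using car q e(2) xc by (simp add: m_assoc)
  also have "\<dots> = k1 \<otimes> inv (r \<otimes> (g \<otimes> v \<otimes> inv g) \<otimes> inv r) \<otimes> inv k"
    unfolding d1 x(4) using car uvc q by (simp add: group_norm)
  finally have "j \<in> K" using v x(3) y(3) by simp
  thus ?thesis using jH jx e by blast
qed

text \<open>The core of the argument: \<open>q\<close> and \<open>r\<close> represent an \<open>H\<close>-orbit and a \<open>K\<close>-orbit of vertices over \<open>S s\<close>, and \<open>F\<close> and \<open>E\<close> represent the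
edges of \<open>U\<close> and \<open>V\<close> at these vertices. An edge \<open>x = h q f c = k r g d\<close> of \<open>U \<inter> V\<close> gives the double coset
\<open>vtx f g (c \<otimes> inv d)\<close>, which depends only on the vertex of \<open>x\<close>, and an element of a fibre over it, which determines the
orbit of \<open>x\<close>. Outside a finite set \<open>\<Delta>\<close> of double cosets, the f.c.i.p. gives one edge at the vertex modulo its stabiliser,
and the \<open>C\<close>-f.g.i.p. says that the stabiliser fixes this edge, so the vertex is a leaf. The branching edges thus lie over \<open>\<Delta>\<close>,
where the fibres are finite.\<close>

theorem finite_branching_over_pair:
  assumes fcip: "fcip_rel (G\<lparr>carrier := S s\<rparr>) C" and pair: "pair_fgip (G\<lparr>carrier := S s\<rparr>) C"
    and H: "subgroup H G" and K: "subgroup K G" and q: "q \<in> carrier G" "r \<in> carrier G"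
  defines "Hq \<equiv> S s \<inter> conj_subgroup G H q" and "Kr \<equiv> S s \<inter> conj_subgroup G K r"
  assumes fgH: "fg_subgroup Hq G" and fgK: "fg_subgroup Kr G"
    and U: "U \<subseteq> carrier G" "\<And>h u. h \<in> H \<Longrightarrow> u \<in> U \<Longrightarrow> h \<otimes> u \<in> U"
    and V: "V \<subseteq> carrier G" "\<And>h u. h \<in> K \<Longrightarrow> u \<in> V \<Longrightarrow> h \<otimes> u \<in> V"
    and F: "finite F" "F \<subseteq> S s" "inj_on (\<lambda>f. double_coset G Hq f C) F"
      "\<And>a. a \<in> S s \<Longrightarrow> q \<otimes> a \<in> U \<Longrightarrow> \<exists>f\<in>F. a \<in> double_coset G Hq f C"
    and E: "finite E" "E \<subseteq> S s" "inj_on (\<lambda>f. double_coset G Kr f C) E"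
      "\<And>a. a \<in> S s \<Longrightarrow> r \<otimes> a \<in> V \<Longrightarrow> \<exists>f\<in>E. a \<in> double_coset G Kr f C"
  shows "\<exists>Y. finite Y \<and> Y \<subseteq> U \<inter> V \<and> (\<forall>x\<in>branching s (U \<inter> V).
           (\<exists>h\<in>H. \<exists>a\<in>S s. x = h \<otimes> q \<otimes> a) \<longrightarrow> (\<exists>k\<in>K. \<exists>a\<in>S s. x = k \<otimes> r \<otimes> a) \<longrightarrow>
           x \<in> (H \<inter> K) <#> Y <#> C)"
proof -
  let ?A = "G\<lparr>carrier := S s\<rparr>"
  interpret H: subgroup H G by (rule H)
  interpret K: subgroup K G by (rule K)
  interpret A: group ?A by (rule subgroup_imp_group[OF subS])
  have sB: "subgroup Hq G" "subgroup Kr G" using fgH fgK fg_subgroup_imp_subgroup by auto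
  have Bc: "Hq \<subseteq> carrier G" "Kr \<subseteq> carrier G" using sB subgroup.subset by auto
  have subA: "subgroup Hq ?A" "subgroup Kr ?A" "subgroup C ?A"
    using subgroup_incl[OF sB(1) subS] subgroup_incl[OF sB(2) subS] subgroup_incl[OF subC subS C_S] by (auto simp: Hq_def Kr_def)
  have fgA: "fg_subgroup Hq ?A" "fg_subgroup Kr ?A"
    using fgH fgK fg_subgroup_carrier_iff[OF subS] by (auto simp: Hq_def Kr_def)
  have conjA: "conj_subgroup ?A N a = conj_subgroup G N a" if "a \<in> S s" for N a
    by (rule conj_subgroup_carrier_update[OF subS that])
  have invA: "inv\<^bsub>?A\<^esub> a = inv a" if "a \<in> S s" for a by (rule m_inv_consistent[OF subS that])
  \<comment> \<open>The element of the fibre that an edge defines, and the double coset that its vertex defines.\<close>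
  define cls where "cls f g c d = double_coset G (C \<inter> conj_subgroup G Hq f) (c \<otimes> inv d) (C \<inter> conj_subgroup G Kr g)" for f g c d
  define vtx where "vtx f g e = double_coset G Hq (f \<otimes> e \<otimes> inv g) Kr" for f g e
  define fib where "fib = fibres ?A C Hq Kr F E"
  have cdC: "c \<otimes> inv d \<in> C" if "c \<in> C" "d \<in> C" for c d
    using that subC by (meson subgroup.m_closed subgroup.m_inv_closed)
  have vtx_in: "vtx f g e \<in> double_cosets ?A Hq Kr" if "f \<in> S s" "g \<in> S s" "e \<in> C" for f g e
    using that C_S unfolding vtx_def double_cosets_def
    by (auto intro!: subgroup.m_closed[OF subS] subgroup.m_inv_closed[OF subS] imageI)
  have fib_in: "(f, g, cls f g c d) \<in> fib (vtx f g (c \<otimes> inv d))"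
    if fg: "f \<in> F" "g \<in> E" "c \<in> C" "d \<in> C" for f g c d
  proof -
    have S: "f \<in> S s" "g \<in> S s" using fg F E by auto
    have "dc_map ?A Hq Kr f g (cls f g c d) = vtx f g (c \<otimes> inv d)"
      using A.dc_map_double_coset[OF subA(3,1,2), of f g "c \<otimes> inv d"] S cdC[OF fg(3,4)]
      by (simp add: conjA invA cls_def vtx_def)
    moreover have "cls f g c d \<in> double_cosets (?A\<lparr>carrier := C\<rparr>) (C \<inter> conj_subgroup ?A Hq f) (C \<inter> conj_subgroup ?A Kr g)"
      using cdC[OF fg(3,4)] S by (auto simp: double_cosets_def cls_def conjA)
    ultimately show ?thesis using fg by (simp add: fib_def fibres_def dc_fibre_def)
  qed
  \<comment> \<open>The elements of \<open>C\<close> that are exceptional for the \<open>C\<close>-f.g.i.p.\<close>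
  define wild where "wild f g = {e \<in> C. \<not> conj_subgroup G (conj_subgroup G Hq f) e \<inter> conj_subgroup G Kr g \<subseteq> C}" for f g
  have fin_wild: "finite (vtx f g ` wild f g)" if fg: "f \<in> F" "g \<in> E" for f g
  proof -
    have S: "f \<in> S s" "g \<in> S s" using fg F E by auto
    have Sc: "f \<in> carrier G" "g \<in> carrier G" using S S_carrier by auto
    have sub: "conj_subgroup G Hq f \<subseteq> S s" "conj_subgroup G Kr g \<subseteq> S s"
    proof -
      have "inv a \<otimes> b \<otimes> a \<in> S s" if "a \<in> S s" "b \<in> S s" for a b
        using that subS by (meson subgroup.m_closed subgroup.m_inv_closed)
      thus "conj_subgroup G Hq f \<subseteq> S s" "conj_subgroup G Kr g \<subseteq> S s"
        using S by (auto simp: conj_subgroup_image Hq_def Kr_def)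
    qed
    have "fg_subgroup (conj_subgroup G Hq f) ?A" "fg_subgroup (conj_subgroup G Kr g) ?A"
      using fg_conj_subgroup[OF fgH Sc(1)] fg_conj_subgroup[OF fgK Sc(2)] sub
        fg_subgroup_carrier_iff[OF subS] by auto
    hence "finite {double_coset ?A (conj_subgroup G Hq f) e (conj_subgroup G Kr g) | e.
        e \<in> C \<and> \<not> conj_subgroup ?A (conj_subgroup G Hq f) e \<inter> conj_subgroup G Kr g \<subseteq> C}"
      using pair unfolding pair_fgip_def by blast
    moreover have "(\<lambda>e. double_coset G (conj_subgroup G Hq f) e (conj_subgroup G Kr g)) ` wild f g \<subseteq>
      {double_coset ?A (conj_subgroup G Hq f) e (conj_subgroup G Kr g) | e.
        e \<in> C \<and> \<not> conj_subgroup ?A (conj_subgroup G Hq f) e \<inter> conj_subgroup G Kr g \<subseteq> C}"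
    proof (rule image_subsetI)
      fix e assume e: "e \<in> wild f g"
      hence "e \<in> S s" using C_S by (auto simp: wild_def)
      thus "double_coset G (conj_subgroup G Hq f) e (conj_subgroup G Kr g) \<in>
      {double_coset ?A (conj_subgroup G Hq f) e (conj_subgroup G Kr g) | e.
        e \<in> C \<and> \<not> conj_subgroup ?A (conj_subgroup G Hq f) e \<inter> conj_subgroup G Kr g \<subseteq> C}"
        using e conjA[of e] unfolding wild_def by auto
    qed
    ultimately have fin: "finite ((\<lambda>e. double_coset G (conj_subgroup G Hq f) e (conj_subgroup G Kr g)) ` wild f g)"
      by (rule rev_finite_subset)
    \<comment> \<open>The exceptional double cosets of the conjugated subgroups are carried to double cosets of \<open>Hq\<close> and \<open>Kr\<close>.\<close>
    have "vtx f g e = dc_map G Hq Kr f g (double_coset G (conj_subgroup G Hq f) e (conj_subgroup G Kr g))"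
      if "e \<in> wild f g" for e
    proof -
      have "e \<in> S s" using that C_S by (auto simp: wild_def)
      moreover have "S s \<inter> conj_subgroup G Hq f = conj_subgroup G Hq f"
        "S s \<inter> conj_subgroup G Kr g = conj_subgroup G Kr g" using sub by auto
      ultimately show ?thesis
        using dc_map_double_coset[OF subS sB Sc, of e s] by (simp add: vtx_def)
    qed
    hence "vtx f g ` wild f g = dc_map G Hq Kr f g `
        ((\<lambda>e. double_coset G (conj_subgroup G Hq f) e (conj_subgroup G Kr g)) ` wild f g)"
      unfolding image_image by (rule image_cong[OF HOL.refl])
    thus ?thesis using fin by simp
  qed
  define \<Delta> where "\<Delta> = {D \<in> double_cosets ?A Hq Kr. \<exists>t\<in>fib D. \<exists>u\<in>fib D. t \<noteq> u}
      \<union> (\<Union>f\<in>F. \<Union>g\<in>E. vtx f g ` wild f g)"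
  have Fc: "F \<subseteq> carrier ?A" "E \<subseteq> carrier ?A" using F E by auto
  have inj: "inj_on (\<lambda>f. double_coset ?A Hq f C) F" "inj_on (\<lambda>f. double_coset ?A Kr f C) E"
    using F E by auto
  note fcip' = fcip_rel_finite_fibres[OF fcip fgA F(1) Fc(1) inj(1) E(1) Fc(2) inj(2), folded fib_def]
  have fin\<Delta>: "finite \<Delta>" unfolding \<Delta>_def using fcip'(2) fin_wild F(1) E(1) by blast
  have \<Delta>_in: "\<Delta> \<subseteq> double_cosets ?A Hq Kr"
    using vtx_in F E unfolding \<Delta>_def wild_def by blast
  define T where "T = (\<Union>D\<in>\<Delta>. fib D)"
  have finT: "finite T" unfolding T_def using fin\<Delta> \<Delta>_in fcip'(1) by blast
  define rep where "rep x f g c d \<longleftrightarrow> f \<in> F \<and> g \<in> E \<and> c \<in> C \<and> d \<in> C \<and>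
      (\<exists>h\<in>H. x = h \<otimes> q \<otimes> f \<otimes> c) \<and> (\<exists>k\<in>K. x = k \<otimes> r \<otimes> g \<otimes> d)" for x f g c d
  have ex_rep: "\<exists>f g c d. rep x f g c d" if "x \<in> U \<inter> V" "h \<in> H" "a \<in> S s" "x = h \<otimes> q \<otimes> a"
      "k \<in> K" "b \<in> S s" "x = k \<otimes> r \<otimes> b" for x h a k b
  proof -
    have "\<exists>f\<in>F. \<exists>c\<in>C. \<exists>h\<in>H. x = h \<otimes> q \<otimes> f \<otimes> c"
      using that(1) by (intro ex_edge_rep[OF H q(1) F(2) U(2) F(4)[unfolded Hq_def] _ that(2-4)]) auto
    moreover have "\<exists>f\<in>E. \<exists>c\<in>C. \<exists>h\<in>K. x = h \<otimes> r \<otimes> f \<otimes> c"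
      using that(1) by (intro ex_edge_rep[OF K q(2) E(2) V(2) E(4)[unfolded Kr_def] _ that(5-7)]) auto
    ultimately show ?thesis unfolding rep_def by blast
  qed
  have same: "\<exists>j\<in>H \<inter> K. \<exists>e\<in>C. y = j \<otimes> x \<otimes> e"
    if "rep x f g c d" "rep y f g c1 d1" "c1 \<otimes> inv d1 \<in> cls f g c d" for x y f g c d c1 d1
  proof -
    obtain h k h1 k1 where *: "f \<in> S s" "g \<in> S s" "c \<in> C" "d \<in> C" "c1 \<in> C" "d1 \<in> C"
      "h \<in> H" "x = h \<otimes> q \<otimes> f \<otimes> c" "k \<in> K" "x = k \<otimes> r \<otimes> g \<otimes> d"
      "h1 \<in> H" "y = h1 \<otimes> q \<otimes> f \<otimes> c1" "k1 \<in> K" "y = k1 \<otimes> r \<otimes> g \<otimes> d1"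
      using \<open>rep x f g c d\<close> \<open>rep y f g c1 d1\<close> F(2) E(2) unfolding rep_def by blast
    show ?thesis
      using edge_reps_same_class[OF H K q *] that(3) unfolding cls_def Hq_def Kr_def by blast
  qed
  have same_vtx: "vtx f g (c \<otimes> inv d) = vtx f1 g1 (c1 \<otimes> inv d1)"
    if rx: "rep x f g c d" and ry: "rep y f1 g1 c1 d1" and xy: "same_coset G (S s) x y" for x y f g c d f1 g1 c1 d1
  proof -
    obtain h k h1 k1 where *: "f \<in> S s" "g \<in> S s" "c \<in> C" "d \<in> C" "f1 \<in> S s" "g1 \<in> S s" "c1 \<in> C" "d1 \<in> C"
      "h \<in> H" "x = h \<otimes> q \<otimes> f \<otimes> c" "k \<in> K" "x = k \<otimes> r \<otimes> g \<otimes> d"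
      "h1 \<in> H" "y = h1 \<otimes> q \<otimes> f1 \<otimes> c1" "k1 \<in> K" "y = k1 \<otimes> r \<otimes> g1 \<otimes> d1"
      using rx ry F(2) E(2) unfolding rep_def by blast
    define a where "a = inv x \<otimes> y"
    obtain b where b: "b \<in> Hq" "f1 \<otimes> c1 = b \<otimes> (f \<otimes> c \<otimes> a)"
      using edge_reps_same_vertex[OF H q(1) *(1,3,5,7,9,10,13,14) xy] unfolding a_def Hq_def Kr_def by blast
    obtain e where e: "e \<in> Kr" "g1 \<otimes> d1 = e \<otimes> (g \<otimes> d \<otimes> a)"
      using edge_reps_same_vertex[OF K q(2) *(2,4,6,8,11,12,15,16) xy] unfolding a_def Hq_def Kr_def by blast
    have car: "f \<in> carrier G" "g \<in> carrier G" "c \<in> carrier G" "d \<in> carrier G" "f1 \<in> carrier G"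
      "g1 \<in> carrier G" "c1 \<in> carrier G" "d1 \<in> carrier G" "b \<in> carrier G" "e \<in> carrier G" "a \<in> carrier G"
      using *(1-8) b(1) e(1) Bc S_carrier C_carrier xy by (auto simp: a_def same_coset_def)
    have "f1 \<otimes> (c1 \<otimes> inv d1) \<otimes> inv g1 = (f1 \<otimes> c1) \<otimes> inv (g1 \<otimes> d1)" using car by (simp add: group_norm)
    also have "\<dots> = b \<otimes> (f \<otimes> (c \<otimes> inv d) \<otimes> inv g \<otimes> inv e)"
      unfolding b(2) e(2) using car by (simp add: group_norm)
    finally have "f1 \<otimes> (c1 \<otimes> inv d1) \<otimes> inv g1 \<in> vtx f g (c \<otimes> inv d)"
      unfolding vtx_def mem_double_coset using b(1) e(1) subgroup.m_inv_closed[OF sB(2)] by blast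
    moreover have "f \<otimes> (c \<otimes> inv d) \<otimes> inv g \<in> carrier G" using car by simp
    ultimately show ?thesis unfolding vtx_def using double_coset_eqI[OF sB] by metis
  qed
  have cls_self: "c \<otimes> inv d \<in> cls f g c d" if "f \<in> F" "g \<in> E" "c \<in> C" "d \<in> C" for f g c d
  proof -
    have "f \<in> carrier G" "g \<in> carrier G" "c \<otimes> inv d \<in> carrier G"
      using that F E S_carrier cdC[OF that(3,4)] C_carrier by auto
    thus ?thesis unfolding cls_def
      by (intro double_coset_self subgroups_Inter_pair subC subgroup_conj_subgroup sB)
  qed
  \<comment> \<open>If the double coset is not exceptional, then every edge \<open>y\<close> of \<open>U \<inter> V\<close> at the vertex of \<open>x\<close> equals that of \<open>x\<close>.\<close>
  have tame: "vtx f g (c \<otimes> inv d) \<in> \<Delta>"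
    if x: "x \<in> branching s (U \<inter> V)" and rx: "rep x f g c d" for x f g c d
  proof (rule ccontr)
    assume n\<Delta>: "vtx f g (c \<otimes> inv d) \<notin> \<Delta>"
    obtain y where y: "x \<in> U \<inter> V" "y \<in> U \<inter> V" "same_coset G (S s) x y" "\<not> same_coset G C x y"
      using x by (auto simp: branching_def)
    obtain h k where *: "f \<in> F" "g \<in> E" "c \<in> C" "d \<in> C" "h \<in> H" "x = h \<otimes> q \<otimes> f \<otimes> c" "k \<in> K" "x = k \<otimes> r \<otimes> g \<otimes> d"
      using rx unfolding rep_def by blast
    have Ss: "f \<in> S s" "g \<in> S s" "c \<in> S s" "d \<in> S s" using *(1-4) F(2) E(2) C_S[of s] by auto
    hence car: "f \<in> carrier G" "g \<in> carrier G" "c \<in> carrier G" "d \<in> carrier G" using S_carrier by auto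
    have hk: "h \<in> carrier G" "k \<in> carrier G" using * by auto
    have xy: "x \<in> carrier G" "y \<in> carrier G" "inv x \<otimes> y \<in> S s" using y(3) by (auto simp: same_coset_def)
    have "x \<otimes> (inv x \<otimes> y) = h \<otimes> q \<otimes> (f \<otimes> c \<otimes> (inv x \<otimes> y))"
      by (subst *(6)) (use car hk q xy in \<open>simp add: m_assoc\<close>)
    hence y1: "y = h \<otimes> q \<otimes> (f \<otimes> c \<otimes> (inv x \<otimes> y))" using xy by simp
    have "x \<otimes> (inv x \<otimes> y) = k \<otimes> r \<otimes> (g \<otimes> d \<otimes> (inv x \<otimes> y))"
      by (subst *(8)) (use car hk q xy in \<open>simp add: m_assoc\<close>)
    hence y2: "y = k \<otimes> r \<otimes> (g \<otimes> d \<otimes> (inv x \<otimes> y))" using xy by simp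
    have "f \<otimes> c \<otimes> (inv x \<otimes> y) \<in> S s" "g \<otimes> d \<otimes> (inv x \<otimes> y) \<in> S s"
      using Ss xy by (auto intro!: subgroup.m_closed[OF subS])
    then obtain f1 g1 c1 d1 where ry: "rep y f1 g1 c1 d1"
      using ex_rep[OF y(2) *(5) _ y1 *(7) _ y2] by blast
    have **: "f1 \<in> F" "g1 \<in> E" "c1 \<in> C" "d1 \<in> C" using ry unfolding rep_def by auto
    have v_in: "vtx f g (c \<otimes> inv d) \<in> double_cosets ?A Hq Kr"
      by (rule vtx_in[OF Ss(1,2) cdC[OF *(3,4)]])
    have alone: "t = u" if "t \<in> fib (vtx f g (c \<otimes> inv d))" "u \<in> fib (vtx f g (c \<otimes> inv d))" for t u
    proof (rule ccontr)
      assume "t \<noteq> u"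
      with that v_in have "vtx f g (c \<otimes> inv d) \<in> {D \<in> double_cosets ?A Hq Kr. \<exists>t\<in>fib D. \<exists>u\<in>fib D. t \<noteq> u}"
        by (intro CollectI conjI bexI)
      thus False using n\<Delta> unfolding \<Delta>_def by (rule notE[rotated, OF UnI1])
    qed
    have eq: "(f, g, cls f g c d) = (f1, g1, cls f1 g1 c1 d1)"
      by (rule alone[OF fib_in[OF *(1-4)]]) (unfold same_vtx[OF rx ry y(3)], rule fib_in[OF **])
    hence "rep y f g c1 d1" "c1 \<otimes> inv d1 \<in> cls f g c d" using ry cls_self[OF **] by auto
    then obtain j e where j: "j \<in> H" "j \<in> K" "e \<in> C" "y = j \<otimes> x \<otimes> e" using same[OF rx] by blast
    have jc: "j \<in> carrier G" "e \<in> carrier G" "e \<in> S s" using j C_carrier C_S by auto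
    \<comment> \<open>The element \<open>j\<close> of \<open>H \<inter> K\<close> fixes the vertex of \<open>x\<close>; it fixes the edge \<open>x\<close> if \<open>t\<close> lies in \<open>C\<close>.\<close>
    define t where "t = inv x \<otimes> j \<otimes> x"
    have xye: "inv x \<otimes> y = t \<otimes> e" using j(4) jc xy by (simp add: t_def m_assoc)
    have "t = inv x \<otimes> y \<otimes> inv e" unfolding xye using jc xy by (simp add: t_def m_assoc)
    hence tS: "t \<in> S s" using xy(3) jc(3) by (simp add: subgroup.m_closed[OF subS] subgroup.m_inv_closed[OF subS])
    hence tc: "t \<in> carrier G" by (rule S_carrier)
    define t' where "t' = d \<otimes> t \<otimes> inv d"
    have t'S: "t' \<in> S s" "t' \<in> carrier G"
      using tS Ss S_carrier by (auto simp: t'_def intro!: subgroup.m_closed[OF subS] subgroup.m_inv_closed[OF subS])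
    have xt: "x \<otimes> t \<otimes> inv x = j" using xy jc by (simp add: t_def m_assoc)
    have "inv k \<otimes> j \<otimes> k \<in> K" using j * by simp
    moreover have "inv k \<otimes> (x \<otimes> t \<otimes> inv x) \<otimes> k = r \<otimes> (g \<otimes> t' \<otimes> inv g) \<otimes> inv r"
      unfolding t'_def by (subst *(8), subst *(8)) (use car hk q tc in \<open>simp add: group_norm\<close>)
    ultimately have "r \<otimes> (g \<otimes> t' \<otimes> inv g) \<otimes> inv r \<in> K" by (simp add: xt)
    moreover have "g \<otimes> t' \<otimes> inv g \<in> S s"
      using t'S Ss by (auto intro!: subgroup.m_closed[OF subS] subgroup.m_inv_closed[OF subS])
    ultimately have t1: "t' \<in> conj_subgroup G Kr g"
      using t'S car q K.subset Bc by (simp add: mem_conj_subgroup S_carrier Hq_def Kr_def)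
    let ?e = "c \<otimes> inv d"
    have ec: "?e \<in> carrier G" "?e \<in> C" using car cdC * by auto
    have "inv h \<otimes> j \<otimes> h \<in> H" using j * by simp
    moreover have "inv h \<otimes> (x \<otimes> t \<otimes> inv x) \<otimes> h = q \<otimes> (f \<otimes> (?e \<otimes> t' \<otimes> inv ?e) \<otimes> inv f) \<otimes> inv q"
      unfolding t'_def by (subst *(6), subst *(6)) (use car hk q tc in \<open>simp add: group_norm\<close>)
    ultimately have "q \<otimes> (f \<otimes> (?e \<otimes> t' \<otimes> inv ?e) \<otimes> inv f) \<otimes> inv q \<in> H" by (simp add: xt)
    moreover have "f \<otimes> (?e \<otimes> t' \<otimes> inv ?e) \<otimes> inv f \<in> S s"
      using t'S Ss by (auto intro!: subgroup.m_closed[OF subS] subgroup.m_inv_closed[OF subS])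
    moreover have "conj_subgroup G Hq f \<subseteq> carrier G" using conj_subgroup_subset[OF Bc(1)] car by blast
    ultimately have t2: "t' \<in> conj_subgroup G (conj_subgroup G Hq f) ?e"
      using t'S car q ec(1) H.subset Bc by (simp add: mem_conj_subgroup S_carrier Hq_def Kr_def)
    have "?e \<notin> wild f g" using n\<Delta> * unfolding \<Delta>_def by blast
    hence "t' \<in> C" using t1 t2 ec by (auto simp: wild_def)
    hence "inv d \<otimes> t' \<otimes> d \<in> C" using * subC by (meson subgroup.m_closed subgroup.m_inv_closed)
    moreover have "inv d \<otimes> t' \<otimes> d = t" using tc car by (simp add: t'_def m_assoc)
    ultimately have "inv x \<otimes> y \<in> C" unfolding xye using j subgroup.m_closed[OF subC] by simp
    thus False using y(4) xy by (simp add: same_coset_def)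
  qed
  \<comment> \<open>One edge is chosen for each of the finitely many elements of the fibres over \<open>\<Delta>\<close>.\<close>
  define is_rep where "is_rep t x \<longleftrightarrow> x \<in> U \<inter> V \<and>
      (\<exists>f g c d. rep x f g c d \<and> t = (f, g, cls f g c d))" for t x
  define Y where "Y = (\<lambda>t. SOME x. is_rep t x) ` {t \<in> T. \<exists>x. is_rep t x}"
  have Y_rep: "is_rep t (SOME x. is_rep t x)" if "is_rep t x" for t x
    using that by (rule someI)
  have Y_UV: "Y \<subseteq> U \<inter> V"
  proof
    fix z assume "z \<in> Y"
    then obtain t x where "is_rep t x" "z = (SOME x. is_rep t x)" unfolding Y_def by blast
    thus "z \<in> U \<inter> V" using Y_rep[of t x] unfolding is_rep_def by blast
  qed
  have hit: "x \<in> (H \<inter> K) <#> Y <#> C"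
    if x: "x \<in> branching s (U \<inter> V)" "h \<in> H" "a \<in> S s" "x = h \<otimes> q \<otimes> a" "k \<in> K" "b \<in> S s" "x = k \<otimes> r \<otimes> b" for x h a k b
  proof -
    have xUV: "x \<in> U \<inter> V" using x(1) by (simp add: branching_def)
    obtain f g c d where rx: "rep x f g c d" using ex_rep[OF xUV x(2-)] by blast
    have *: "f \<in> F" "g \<in> E" "c \<in> C" "d \<in> C" using rx unfolding rep_def by auto
    let ?t = "(f, g, cls f g c d)"
    have "?t \<in> T" unfolding T_def using fib_in[OF *] tame[OF x(1) rx] by blast
    have ir: "is_rep ?t x" using rx xUV unfolding is_rep_def by blast
    define y where "y = (SOME x. is_rep ?t x)"
    have "y \<in> Y" unfolding Y_def y_def using \<open>?t \<in> T\<close> ir by blast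
    have "is_rep ?t y" unfolding y_def by (rule Y_rep[OF ir])
    then obtain c1 d1 where "rep y f g c1 d1" "cls f g c d = cls f g c1 d1" unfolding is_rep_def by blast
    then obtain j e where "j \<in> H \<inter> K" "e \<in> C" "x = j \<otimes> y \<otimes> e"
      using same[of y f g c1 d1 x c d] rx cls_self[OF *] by auto
    thus ?thesis unfolding mem_hull using \<open>y \<in> Y\<close> by blast
  qed
  show ?thesis
  proof (intro exI[of _ Y] conjI ballI impI)
    show "finite Y" using finT by (simp add: Y_def)
    show "Y \<subseteq> U \<inter> V" by (rule Y_UV)
    fix x
    assume x: "x \<in> branching s (U \<inter> V)" "\<exists>h\<in>H. \<exists>a\<in>S s. x = h \<otimes> q \<otimes> a" "\<exists>k\<in>K. \<exists>a\<in>S s. x = k \<otimes> r \<otimes> a"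
    from x(2,3) obtain h a k b where "h \<in> H" "a \<in> S s" "x = h \<otimes> q \<otimes> a" "k \<in> K" "b \<in> S s" "x = k \<otimes> r \<otimes> b"
      by (elim bexE)
    from hit[OF x(1) this] show "x \<in> (H \<inter> K) <#> Y <#> C" .
  qed
qed

end

section \<open>The main theorem\<close>

context amalgam
begin

theorem finite_branching:
  assumes rel: "fgip_rel G C"
    and fcip: "fcip_rel (G\<lparr>carrier := S s\<rparr>) C" and pair: "pair_fgip (G\<lparr>carrier := S s\<rparr>) C"
    and fgH: "fg_subgroup H G" and fgK: "fg_subgroup K G"
    and Q: "finite Q" "Q \<subseteq> carrier G" and R: "finite R" "R \<subseteq> carrier G"
  shows "\<exists>Y. finite Y \<and> Y \<subseteq> (H <#> Q <#> C) \<inter> (K <#> R <#> C) \<and>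
      branching s ((H <#> Q <#> C) \<inter> (K <#> R <#> C)) \<subseteq> (H \<inter> K) <#> Y <#> C"
proof -
  let ?U = "H <#> Q <#> C" and ?V = "K <#> R <#> C"
  have H: "subgroup H G" and K: "subgroup K G" using fgH fgK fg_subgroup_imp_subgroup by auto
  have fg: "fg_subgroup (S s \<inter> conj_subgroup G M q) G" if "fg_subgroup M G" "q \<in> carrier G" for M q
    using fg_inter_factor[OF rel fg_conj_subgroup[OF that], of s] by (simp add: Int_commute)
  define near where "near q r x \<longleftrightarrow>
      (\<exists>h\<in>H. \<exists>a\<in>S s. x = h \<otimes> q \<otimes> a) \<and> (\<exists>k\<in>K. \<exists>a\<in>S s. x = k \<otimes> r \<otimes> a)" for q r x
  have "\<exists>Y. finite Y \<and> Y \<subseteq> ?U \<inter> ?V \<and>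
      (\<forall>x\<in>branching s (?U \<inter> ?V). near q r x \<longrightarrow> x \<in> (H \<inter> K) <#> Y <#> C)" if q: "q \<in> Q" and r: "r \<in> R" for q r
  proof -
    have c: "q \<in> carrier G" "r \<in> carrier G" using q r Q R by auto
    obtain F where F: "finite F" "F \<subseteq> S s" "inj_on (\<lambda>f. double_coset G (S s \<inter> conj_subgroup G H q) f C) F"
      "\<And>a. a \<in> S s \<Longrightarrow> q \<otimes> a \<in> ?U \<Longrightarrow> \<exists>f\<in>F. a \<in> double_coset G (S s \<inter> conj_subgroup G H q) f C"
      using ex_edge_representatives[OF H Q c(1), of s] by blast
    obtain E where E: "finite E" "E \<subseteq> S s" "inj_on (\<lambda>f. double_coset G (S s \<inter> conj_subgroup G K r) f C) E"
      "\<And>a. a \<in> S s \<Longrightarrow> r \<otimes> a \<in> ?V \<Longrightarrow> \<exists>f\<in>E. a \<in> double_coset G (S s \<inter> conj_subgroup G K r) f C"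
      using ex_edge_representatives[OF K R c(2), of s] by blast
    show ?thesis unfolding near_def imp_conjL
      by (rule finite_branching_over_pair[OF fcip pair H K c fg[OF fgH c(1)] fg[OF fgK c(2)]
            hull_carrier[OF H Q(2)] hull_left[OF H Q(2)] hull_carrier[OF K R(2)] hull_left[OF K R(2)] F E])
  qed
  then obtain Y where Y: "\<And>q r. q \<in> Q \<Longrightarrow> r \<in> R \<Longrightarrow> finite (Y q r) \<and> Y q r \<subseteq> ?U \<inter> ?V \<and>
      (\<forall>x\<in>branching s (?U \<inter> ?V). near q r x \<longrightarrow> x \<in> (H \<inter> K) <#> Y q r <#> C)"
    by metis
  let ?Y = "\<Union>q\<in>Q. \<Union>r\<in>R. Y q r"
  have "x \<in> (H \<inter> K) <#> ?Y <#> C" if x: "x \<in> branching s (?U \<inter> ?V)" for x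
  proof -
    have xU: "x \<in> ?U" "x \<in> ?V" using x by (auto simp: branching_def)
    from xU(1) obtain h q c where h: "h \<in> H" "q \<in> Q" "c \<in> S s" "x = h \<otimes> q \<otimes> c"
      unfolding mem_hull using C_S by blast
    from xU(2) obtain k r d where k: "k \<in> K" "r \<in> R" "d \<in> S s" "x = k \<otimes> r \<otimes> d"
      unfolding mem_hull using C_S by blast
    have "near q r x" unfolding near_def using h k by blast
    hence "x \<in> (H \<inter> K) <#> Y q r <#> C" using Y[OF h(2) k(2)] x by blast
    thus ?thesis unfolding mem_hull using h(2) k(2) by blast
  qed
  moreover have "finite ?Y" using Y Q(1) R(1) by blast
  moreover have "?Y \<subseteq> ?U \<inter> ?V" using Y by blast
  ultimately show ?thesis by blast
qed

theorem fgip_if_fgip_rel: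
  assumes rel: "fgip_rel G C"
    and fcip: "fcip_rel (G\<lparr>carrier := S s\<rparr>) C" and pair: "pair_fgip (G\<lparr>carrier := S s\<rparr>) C"
    and other: "fgip (G\<lparr>carrier := S (\<not> s)\<rparr>)"
  shows "fgip G"
  unfolding fgip_def
proof (intro allI impI)
  fix H K assume fgH: "fg_subgroup H G" and fgK: "fg_subgroup K G"
  have H: "subgroup H G" and K: "subgroup K G" using fgH fgK fg_subgroup_imp_subgroup by auto
  have J: "subgroup (H \<inter> K) G" using H K subgroups_Inter_pair by blast
  obtain Q where Q: "finite Q" "Q \<subseteq> carrier G" "\<one> \<in> Q" "connected_in (H <#> Q <#> C)"
    using ex_connected_hull[OF fgH] by blast
  obtain R where R: "finite R" "R \<subseteq> carrier G" "\<one> \<in> R" "connected_in (K <#> R <#> C)"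
    using ex_connected_hull[OF fgK] by blast
  define Z where "Z = (H <#> Q <#> C) \<inter> (K <#> R <#> C)"
  obtain Y where Y: "finite Y" "Y \<subseteq> Z" "branching s Z \<subseteq> (H \<inter> K) <#> Y <#> C"
    using finite_branching[OF rel fcip pair fgH fgK Q(1,2) R(1,2)] unfolding Z_def by blast
  note HU = hull_left[OF H Q(2)] hull_right[OF H Q(2)] hull_carrier[OF H Q(2)]
  note KV = hull_left[OF K R(2)] hull_right[OF K R(2)] hull_carrier[OF K R(2)]
  have one: "\<one> \<in> H <#> Q <#> C" "\<one> \<in> K <#> R <#> C"
    using subset_hull[OF H Q(2)] subset_hull[OF K R(2)] Q(3) R(3) by auto
  have Zc: "Z \<subseteq> carrier G" using HU(3) by (auto simp: Z_def)
  have conZ: "connected_in Z" unfolding Z_def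
    by (rule connected_in_inter[OF Q(4) one(1) HU(3) _ R(4) one(2) KV(3)]) (auto intro: HU(2) KV(2))
  \<comment> \<open>The edge \<open>\<one>\<close> is added so that the pruned tree is not empty.\<close>
  let ?Y = "insert \<one> Y" and ?J = "H \<inter> K"
  define W where "W = ?J <#> ?Y <#> C"
  have Yc: "?Y \<subseteq> carrier G" and YZ: "?Y \<subseteq> Z" using Y(2) Zc one by (auto simp: Z_def)
  have WZ: "W \<subseteq> Z"
  proof
    fix w assume "w \<in> W"
    then obtain j y c where w: "j \<in> ?J" "y \<in> Z" "c \<in> C" "w = j \<otimes> y \<otimes> c"
      unfolding W_def mem_hull using YZ by blast
    hence "j \<in> H" "j \<in> K" "y \<in> H <#> Q <#> C" "y \<in> K <#> R <#> C" by (auto simp: Z_def)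
    thus "w \<in> Z" unfolding Z_def w(4) using w(3) HU(1,2) KV(1,2) by blast
  qed
  have "branching s Z \<subseteq> W"
  proof
    fix z assume "z \<in> branching s Z"
    hence "z \<in> ?J <#> Y <#> C" using Y(3) by blast
    thus "z \<in> W" unfolding W_def mem_hull by blast
  qed
  hence conW: "connected_in W" using connected_in_prune[OF conZ Zc _ WZ] by blast
  have fgip: "fgip (G\<lparr>carrier := S t\<rparr>)" for t
    using pair other by (cases "t = s") (auto simp: pair_fgip_def)
  \<comment> \<open>By the f.g.i.p. of the factors; the stabilisers for \<open>H\<close> and \<open>K\<close> are finitely generated by \<open>fg_inter_factor\<close>.\<close>
  have vertex: "fg_subgroup (conj_subgroup G ?J y \<inter> S t) G" if "y \<in> ?Y" for y t
  proof -
    have y: "y \<in> carrier G" using that Yc by blast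
    have "fg_subgroup (conj_subgroup G M y \<inter> S t) (G\<lparr>carrier := S t\<rparr>)" if "fg_subgroup M G" for M
      using fg_inter_factor[OF rel fg_conj_subgroup[OF that y]] fg_subgroup_carrier_iff[OF subS] by blast
    hence "fg_subgroup ((conj_subgroup G H y \<inter> S t) \<inter> (conj_subgroup G K y \<inter> S t)) (G\<lparr>carrier := S t\<rparr>)"
      using fgip[of t] fgH fgK unfolding fgip_def by blast
    moreover have "(conj_subgroup G H y \<inter> S t) \<inter> (conj_subgroup G K y \<inter> S t) = conj_subgroup G ?J y \<inter> S t"
      using y subgroup.subset[OF H] subgroup.subset[OF K] subgroup.subset[OF J] by (auto simp: mem_conj_subgroup)
    ultimately show ?thesis using fg_subgroup_carrier_iff[OF subS] by simp
  qed
  show "fg_subgroup ?J G"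
  proof (rule fg_of_cofinite_action[OF J conW, where Y = ?Y])
    show "W \<subseteq> carrier G" using WZ Zc by blast
    show "?Y \<subseteq> W" unfolding W_def by (rule subset_hull[OF J Yc])
    thus "W \<noteq> {}" by blast
    show "j \<otimes> z \<in> W" if "j \<in> ?J" "z \<in> W" for j z
      using hull_left[OF J Yc that(1)] that(2) unfolding W_def by blast
    show "W \<subseteq> ?J <#> ?Y <#> C" by (simp add: W_def)
  qed (use Y(1) Yc vertex in auto)
qed

end

theorem theoremI:
  fixes G :: "('g, 'm) monoid_scheme" and A B C :: "'g set"
  assumes "amalgamated_free_product G A B C"
    and "fcip_rel (G\<lparr>carrier := A\<rparr>) C"
    and "pair_fgip (G\<lparr>carrier := A\<rparr>) C"
    and "fgip (G\<lparr>carrier := B\<rparr>)"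
  shows "fgip G \<longleftrightarrow> fgip_rel G C"
proof -
  interpret amalgam G "\<lambda>s. if s then A else B" C
    by (rule amalgamated_free_product_imp_amalgam[OF assms(1)])
  have A: "subgroup A G" using subS[of True] by simp
  show ?thesis
  proof
    assume "fgip G"
    moreover have "fg_subgroup C G"
      using assms(2) fg_subgroup_carrier_iff[OF A] by (simp add: fcip_rel_def)
    ultimately show "fgip_rel G C" using subC by (simp add: fgip_def fgip_rel_def)
  next
    assume "fgip_rel G C"
    thus "fgip G" by (rule fgip_if_fgip_rel[of True]) (use assms in simp_all)
  qed
qed

end
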